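(* (Stationary probability measures for a double infinite comb.) Let $(U_n)_{n\ge0}$ be a variable length Markov chain defined by a probabilized double infinite comb. All notation ($\pi(w)$, $\mathcal{P}_i$, $\Theta_i$, formulae (F)) is given in the context. (i) Irreducible case: assume $q_{0^\infty}(0)\ne1$ and $q_{1^\infty}(1)\ne1$. (a) The Markov process $(U_n)_{n\ge0}$ admits a stationary probability measure on $\mathcal{L}$ if and only if the series $\Theta_1$ and $\Theta_2$ converge. (b) If $\Theta_1$ and $\Theta_2$ converge, the stationary probability measure $\pi$ on $\mathcal{L}$ is unique; it is characterized by $$\pi(0)=\frac{\Theta_1}{\Theta_1+\Theta_2},\qquad\pi(10)=\frac{1}{\Theta_1+\Theta_2}$$ and the formulae (F). (ii) Reducible cases. Assume $q_{0^\infty}(0)=1$ and $q_{1^\infty}(1)\ne1$. (a) If at least one of the series $\Theta_1,\Theta_2$ diverges, then the trivial probability measure $\pi$ on $\mathcal{L}$ defined by $\pi(0^\infty)=1$ is the unique stationary probability measure. (b) If $\Theta_1$ and $\Theta_2$ converge, then there is a one-parameter family of stationary probability measures on $\mathcal{L}$. More precisely, for any $a\in[0,1]$ there exists a unique stationary probability measure $\pi_a$ on $\mathcal{L}$ such that $\pi_a(0^\infty)=a$. It is characterized by $$\pi_a(0)=\frac{a\Theta_2+\Theta_1}{\Theta_1+\Theta_2},\qquad\pi_a(10)=\frac{1-a}{\Theta_1+\Theta_2}$$ and the formulae (F). Assume $q_{0^\infty}(0)\neq1$ and $q_{1^\infty}(1)=1$. Then the same results as in (ii)(a) and (ii)(b)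 hold, exchanging the roles of $0$ and $1$. Assume $q_{0^\infty}(0)=1$ and $q_{1^\infty}(1)=1$. (c) If at least one of the series $\Theta_1,\Theta_2$ diverges, then there is a one-parameter family of stationary probability measures on $\mathcal{L}$. More precisely, for any $a\in[0,1]$ there exists a unique stationary probability measure $\pi_a$ on $\mathcal{L}$ such that $\pi_a(0^\infty)=a$. It is characterized by $\pi_a(0^n)=a$ and $\pi_a(1^n)=1-a$ for every $n\ge1$, and $\pi_a(w)=0$ as soon as the finite word $w$ contains one $0$ and one $1$. (d) If $\Theta_1$ and $\Theta_2$ converge, then there is a two-parameter family of stationary probability measures on $\mathcal{L}$. More precisely, for any $a\in[0,1]$ and $b\in[0,1]$ there exists a unique stationary probability measure $\pi_{a,b}$ on $\mathcal{L}$ such that $\pi_{a,b}(0^\infty)=a$ and $\pi_{a,b}(1^\infty)=b$. It is characterized by $$\pi_{a,b}(0)=\frac{a\Theta_2+(1-b)\Theta_1}{\Theta_1+\Theta_2},\qquad\pi_{a,b}(10)=\frac{1-a-b}{\Theta_1+\Theta_2}$$ and the formulae (F).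
   Context: Let $\mathcal{L}=\{0,1\}^{-\mathbb{N}}$ be the set of left-infinite words, with the $\sigma$-algebra generated by cylinders. The double infinite comb is the context tree with set of leaves (contexts) $\mathcal{C}=\{0^n1:n\ge1\}\cup\{1^n0:n\ge1\}\cup\{0^\infty,1^\infty\}$; it is probabilized when each context $c$ carries a probability distribution $q_c$ on $\{0,1\}$. For $U\in\mathcal{L}$, $\mathrm{pref}(U)$ is the leaf obtained by reading $U$ from right to left: $\mathrm{pref}(\ldots10^n)=0^n1$, $\mathrm{pref}(\ldots01^n)=1^n0$ ($n\ge1$), $\mathrm{pref}(\ldots000)=0^\infty$, $\mathrm{pref}(\ldots111)=1^\infty$. The associated variable length Markov chain is the $\mathcal{L}$-valued Markov chain with transitions $\mathbb{P}(U_{n+1}=U_n\ell\mid U_n)=q_{\mathrm{pref}(U_n)}(\ell)$, $\ell\in\{0,1\}$. For a measure $\pi$ on $\mathcal{L}$ and a finite word $w$, $\pi(w)$ denotes the measure of the cylinder of left-infinite words ending with $w$; $\pi(0^\infty)$ (resp. $\pi(1^\infty)$) is the mass of the single word $\ldots000$ (resp. $\ldots111$). $\mathcal{P}_1(n)=\prod_{k=1}^{n-1}q_{0^k1}(0)$, $\mathcal{P}_2(n)=\prod_{k=1}^{n-1}q_{1^k0}(1)$ for $n\ge1$ (empty product $=1$), and $\Theta_i=\sum_{n\ge1}\mathcal{P}_i(n)$, $i=1,2$. Formulae (F): $\pi(10^n)=\pi(10)\mathcal{P}_1(n)$ and $\pi(01^n)=\pi(01)\mathcal{P}_2(n)$ for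 $n\ge1$, where $\pi(01)=\pi(10)$; and $\pi(0^n)=\pi(0)-\pi(10)\sum_{k=1}^{n-1}\mathcal{P}_1(k)$, $\ \pi(1^n)=\pi(1)-\pi(10)\sum_{k=1}^{n-1}\mathcal{P}_2(k)$ for $n\ge2$.
   Formalization: In (ii)(d) the condition a + b ≤ 1 is added: for a + b > 1 (e.g. a = b = 1) no probability measure can have π(0^∞) = a and π(1^∞) = b, since these are masses of two disjoint singletons. *)

theory Defs
  imports "HOL-Probability.Probability" "HOL-Library.Z2"
begin

text \<open>
  Letters are elements of \<^typ>\<open>bit\<close>.  A left-infinite word is represented by the stream of its
  letters read from right to left, so its last letter is the head of the stream and the word
  \<open>U\<close> followed by the letter \<open>l\<close> is \<open>l ## U\<close>.  Finite words are lists written in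
  the usual order: \<open>[1, 0]\<close> is the word 10.
\<close>

instance bit :: finite
proof
  have "(UNIV :: bit set) = {0, 1}"
    by auto
  then show "finite (UNIV :: bit set)"
    by (metis finite.emptyI finite.insertI)
qed

type_synonym left_word = "bit stream"

definition left_words :: "left_word measure" where
  "left_words = stream_space (count_space UNIV)"

text \<open>Left-infinite words ending with \<open>w\<close>.\<close>

definition cyl :: "bit list \<Rightarrow> left_word set" where
  "cyl w = {rev w @- V | V. True}"

lemma left_word_eq_iff: "(U :: left_word) = V \<longleftrightarrow> (\<forall>n. U !! n = V !! n)"
  by (metis ext stream_smap_nats)

lemma shift_in_sstart_UNIV: "(U \<in> sstart UNIV xs) \<longleftrightarrow> (\<exists>V. U = xs @- V)"
proof (induction xs arbitrary: U)
  case (Cons x xs)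
  show ?case
    by (cases U) (auto simp: Cons)
qed simp

lemma cyl_eq_sstart: "cyl w = sstart UNIV (rev w)"
  by (auto simp: cyl_def shift_in_sstart_UNIV)

lemma mem_cyl_iff: "U \<in> cyl w \<longleftrightarrow> (\<forall>i<length w. U !! i = rev w ! i)"
  by (simp add: cyl_eq_sstart sstart_eq)

lemma sets_left_words: "sets left_words = sigma_sets UNIV (range cyl)"
proof -
  have "range cyl = sstart UNIV ` range rev"
    by (auto simp: cyl_eq_sstart image_iff)
  also have "range rev = (UNIV :: bit list set)"
    by (metis surj_def rev_rev_ident)
  finally have r: "range (sstart UNIV) = range cyl" ..
  have "sets left_words = sigma_sets UNIV (range cyl \<union> {{}})"
    unfolding left_words_def by (subst sets_stream_space_sstart) (auto simp: r)
  also have "\<dots> = sigma_sets UNIV (range cyl)"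
    by (intro antisym sigma_sets_mono sigma_sets_mono')
       (auto intro: sigma_sets.Empty sigma_sets.Basic)
  finally show ?thesis .
qed

lemma space_left_words [simp]: "space left_words = UNIV"
  by (simp add: left_words_def space_stream_space)

lemma sets_cyl: "cyl w \<in> sets left_words"
  by (simp add: sets_left_words sigma_sets.Basic)

definition word_mass :: "left_word measure \<Rightarrow> bit list \<Rightarrow> real" where
  "word_mass \<pi> w = measure \<pi> (cyl w)"

text \<open>
  The leaves of the double infinite comb: for the letters \<open>x \<noteq> y\<close>, \<open>Fin_leaf x n\<close> with \<open>n \<ge> 1\<close> is
  the context \<open>x\<^sup>n y\<close>, and \<open>Inf_leaf x\<close> is the infinite context \<open>x x x \<dots>\<close>.  The value
  \<open>Fin_leaf x 0\<close> is not a leaf; it is never a value of \<open>pref\<close> and does not occur in \<open>casc\<close>.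
\<close>

datatype leaf = Fin_leaf bit nat | Inf_leaf bit

definition pref :: "left_word \<Rightarrow> leaf" where
  "pref U = (if U = sconst (shd U) then Inf_leaf (shd U)
             else Fin_leaf (shd U) (LEAST n. U !! n \<noteq> shd U))"

lemma pref_sconst [simp]: "pref (sconst x) = Inf_leaf x"
  by (simp add: pref_def)

lemma pref_run:
  assumes "n \<ge> 1" and "x \<noteq> y"
  shows "pref (replicate n x @- (y ## V)) = Fin_leaf x n"
proof -
  let ?U = "replicate n x @- (y ## V)"
  have hd: "shd ?U = x"
    using assms by (cases n) auto
  have at: "?U !! n = y"
    by (simp add: shift_snth_ge)
  have lt: "?U !! i = x" if "i < n" for i
    using that by (simp add: shift_snth_less)
  have "?U \<noteq> sconst x"
    using at assms by (metis siterate.sel(1) snth_siterate id_funpow id_apply)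
  moreover have "(LEAST i. ?U !! i \<noteq> x) = n"
    using at assms lt by (intro Least_equality) (metis, metis not_le)
  ultimately show ?thesis
    by (simp only: pref_def hd) simp
qed

text \<open>
  A probabilization of the comb is a map \<open>q\<close> sending every leaf to a distribution on the letters.
\<close>

definition vlmc_kernel :: "(leaf \<Rightarrow> bit pmf) \<Rightarrow> left_word \<Rightarrow> left_word measure" where
  "vlmc_kernel q U = distr (measure_pmf (q (pref U))) left_words (\<lambda>l. l ## U)"

text \<open>
  \<open>\<pi>\<close> is a probability measure on left-infinite words, and the law of one step of the chain
  started from \<open>\<pi>\<close> is again \<open>\<pi>\<close>.
\<close>

definition stationary :: "(leaf \<Rightarrow> bit pmf) \<Rightarrow> left_word measure \<Rightarrow> bool" where
  "stationary q \<pi> \<longleftrightarrow> \<pi> \<in> space (prob_algebra left_words) \<and> \<pi> \<bind> vlmc_kernel q = \<pi>"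

instance leaf :: countable
  by countable_datatype

lemma measurable_pref: "pref \<in> left_words \<rightarrow>\<^sub>M count_space UNIV"
proof -
  have eq: "(U = sconst (shd U)) \<longleftrightarrow> (\<forall>n. U !! n = shd U)" for U :: left_word
    by (simp add: left_word_eq_iff[of U])
  show ?thesis
    unfolding pref_def[abs_def] eq left_words_def by measurable
qed

text \<open>The kernel is a measurable Markov kernel, so \<open>\<pi> \<bind> vlmc_kernel q\<close> is the law after one step.\<close>

lemma measurable_vlmc_kernel: "vlmc_kernel q \<in> left_words \<rightarrow>\<^sub>M prob_algebra left_words"
proof -
  have [measurable]: "(\<lambda>U. measure_pmf (q (pref U))) \<in> left_words \<rightarrow>\<^sub>M prob_algebra (count_space UNIV)"
    by (rule measurable_compose[OF measurable_pref]) (simp add: space_prob_algebra prob_space_measure_pmf)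
  have [measurable]: "(\<lambda>(U, l). l ## U) \<in> left_words \<Otimes>\<^sub>M count_space UNIV \<rightarrow>\<^sub>M left_words"
    unfolding left_words_def by measurable
  show ?thesis
    unfolding vlmc_kernel_def[abs_def]
    by (rule measurable_distr_prob_space2[where M = "count_space UNIV"]) measurable
qed

lemma vlmc_kernel_transition: "measure (vlmc_kernel q U) {l ## U} = pmf (q (pref U)) l"
proof -
  have "{l ## U} = {V \<in> space left_words. \<forall>n. V !! n = (l ## U) !! n}"
    by (auto simp: left_word_eq_iff)
  also have "\<dots> \<in> sets left_words"
    unfolding left_words_def by measurable
  finally have sing: "{l ## U} \<in> sets left_words" .
  have "(\<lambda>l. l ## U) \<in> measure_pmf (q (pref U)) \<rightarrow>\<^sub>M left_words"
    by (simp add: left_words_def space_stream_space)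
  then have "measure (vlmc_kernel q U) {l ## U} = measure (measure_pmf (q (pref U))) {l}"
    unfolding vlmc_kernel_def using sing by (subst measure_distr) (auto simp: vimage_def)
  then show ?thesis
    by (simp add: measure_pmf_single)
qed

text \<open>
  For \<open>x = 0\<close> and \<open>x = 1\<close>, \<open>casc q x\<close> is the sequence \<open>\<P>\<^sub>1\<close> resp. \<open>\<P>\<^sub>2\<close>, and \<open>\<Theta> q x\<close> is
  \<open>\<Theta>\<^sub>1\<close> resp. \<open>\<Theta>\<^sub>2\<close>.  The series start at index 1.
\<close>

definition casc :: "(leaf \<Rightarrow> bit pmf) \<Rightarrow> bit \<Rightarrow> nat \<Rightarrow> real" where
  "casc q x n = (\<Prod>k=1..<n. pmf (q (Fin_leaf x k)) x)"

definition \<Theta>_converges :: "(leaf \<Rightarrow> bit pmf) \<Rightarrow> bit \<Rightarrow> bool" where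
  "\<Theta>_converges q x \<longleftrightarrow> summable (\<lambda>n. casc q x (Suc n))"

definition \<Theta> :: "(leaf \<Rightarrow> bit pmf) \<Rightarrow> bit \<Rightarrow> real" where
  "\<Theta> q x = (\<Sum>n. casc q x (Suc n))"

definition comb_formulae :: "(leaf \<Rightarrow> bit pmf) \<Rightarrow> left_word measure \<Rightarrow> bool" where
  "comb_formulae q \<pi> \<longleftrightarrow>
     (\<forall>n\<ge>1. word_mass \<pi> (1 # replicate n 0) = word_mass \<pi> [1, 0] * casc q 0 n) \<and>
     (\<forall>n\<ge>1. word_mass \<pi> (0 # replicate n 1) = word_mass \<pi> [0, 1] * casc q 1 n) \<and>
     word_mass \<pi> [0, 1] = word_mass \<pi> [1, 0] \<and>
     (\<forall>n\<ge>2. word_mass \<pi> (replicate n 0) =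
              word_mass \<pi> [0] - word_mass \<pi> [1, 0] * (\<Sum>k=1..<n. casc q 0 k)) \<and>
     (\<forall>n\<ge>2. word_mass \<pi> (replicate n 1) =
              word_mass \<pi> [1] - word_mass \<pi> [1, 0] * (\<Sum>k=1..<n. casc q 1 k))"

end

theory Submission
  imports Defs
begin

text \<open>
  Indexing by letters, write \<open>\<P>\<^sub>x\<close> and \<open>\<Theta>\<^sub>x\<close> for \<open>casc q x\<close> and \<open>\<Theta> q x\<close>, and let \<open>y\<close> be the letter other
  than \<open>x\<close>.  Fix a stationary law \<open>\<pi>\<close>.  A word that contains both letters ends with some \<open>y x\<^sup>n\<close>, \<open>n \<ge> 1\<close>, which
  determines the context, so appending a letter to it multiplies its mass by a known transition
  probability (\<open>word_mass_snoc\<close>).  Peeling off letters in this way, every mass is reduced to the masses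
  of the constant words \<open>x\<^sup>n\<close>.  Differences of the latter are masses of runs,
  \<open>\<pi>(x\<^sup>n) - \<pi>(x\<^sup>n\<^sup>+\<^sup>1) = \<pi>(y x\<^sup>n) = \<pi>(10) \<P>\<^sub>x(n)\<close>, and the limit of \<open>\<pi>(x\<^sup>n)\<close> is the mass of
  the constant infinite word.  Summing over \<open>n\<close> gives \<open>\<pi>(x) = \<pi>(x\<^sup>\<infinity>) + \<pi>(10) \<Theta>\<^sub>x\<close> (\<open>word_mass_letter\<close>) and hence
  the balance
  \<open>\<pi>(0\<^sup>\<infinity>) + \<pi>(1\<^sup>\<infinity>) + \<pi>(10) (\<Theta>\<^sub>0 + \<Theta>\<^sub>1) = 1\<close>,
  where \<open>\<pi>(10) = 0\<close> as soon as one of the series diverges.  So a stationary law is determined by the two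
  numbers \<open>\<pi>(0\<^sup>\<infinity>)\<close> and \<open>\<pi>(1\<^sup>\<infinity>)\<close> (\<open>stationary_unique\<close>).

  These numbers are constrained only as follows: \<open>\<pi>(x\<^sup>\<infinity>) = 0\<close> unless \<open>x\<^sup>\<infinity>\<close> is absorbing, and the
  sum is at most \<open>1\<close>, with equality unless both series converge.  Every pair that obeys the constraints is realized
  (\<open>stationary_exists\<close>) by a mixture of the point masses at \<open>0\<^sup>\<infinity>\<close> and \<open>1\<^sup>\<infinity>\<close> and of one stationary
  law that charges neither (\<open>stationary_renewal\<close>).  The latter exists when both series converge: read
  from right to left it is an alternating renewal process.  Its complete runs of \<open>x\<close> are independent
  with length at least \<open>n\<close> with probability \<open>\<P>\<^sub>x(n)\<close>, and the last run, the one still growing, is a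
  run of \<open>x\<close> of current length \<open>n\<close> with probability \<open>\<P>\<^sub>x(n) / (\<Theta>\<^sub>0 + \<Theta>\<^sub>1)\<close>, the age distribution
  of the renewal process.  All the cases of the theorem are read off from this description of the
  set of stationary laws.
\<close>

section \<open>The two letters\<close>

definition opp :: "bit \<Rightarrow> bit" where
  "opp x = (if x = 0 then 1 else 0)"

lemma opp_simps [simp]: "opp 0 = 1" "opp 1 = 0" "opp (opp x) = x"
  by (simp_all add: opp_def)

lemma opp_neq [simp]: "opp x \<noteq> x" "x \<noteq> opp x"
  by (cases x; simp)+

lemma eq_or_opp: "l = x \<or> l = opp x"
  by (cases x; cases l; simp)

lemma UNIV_bit: "(UNIV :: bit set) = {x, opp x}"
  using eq_or_opp by auto

section \<open>Cylinders\<close>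

lemma measurable_Stream_left_words [measurable]: "(##) l \<in> left_words \<rightarrow>\<^sub>M left_words"
  unfolding left_words_def by measurable

lemma measurable_stl_left_words [measurable]: "stl \<in> left_words \<rightarrow>\<^sub>M left_words"
  unfolding left_words_def by measurable

lemma measurable_shd_left_words [measurable]: "shd \<in> left_words \<rightarrow>\<^sub>M count_space UNIV"
  unfolding left_words_def by measurable

lemma sets_Stream_image:
  assumes [measurable]: "B \<in> sets left_words"
  shows "(##) l ` B \<in> sets left_words"
proof -
  have "(##) l ` B = {V \<in> space left_words. shd V = l \<and> stl V \<in> B}"
    by (auto simp: stream_eq_Stream_iff image_iff intro!: bexI)
  also have "\<dots> \<in> sets left_words"
    by measurable
  finally show ?thesis .
qed

lemma cyl_Nil [simp]: "cyl [] = UNIV"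
  by (auto simp: cyl_def)

lemma cyl_snoc: "cyl (w @ [l]) = (##) l ` cyl w"
  by (auto simp: cyl_def)

lemma cyl_Cons: "cyl (x # w) = {U \<in> cyl w. U !! length w = x}"
  by (auto simp: mem_cyl_iff nth_append less_Suc_eq rev_nth)

lemma mem_cyl_replicate: "U \<in> cyl (replicate n x) \<longleftrightarrow> (\<forall>i<n. U !! i = x)"
  by (simp add: mem_cyl_iff)

lemma stl_vimage_cyl: "stl -` cyl w = cyl (w @ [0]) \<union> cyl (w @ [1])"
proof -
  have "shd U = 0 \<or> shd U = 1" for U :: left_word
    by (cases "shd U") auto
  then show ?thesis
    unfolding cyl_snoc by (auto simp: image_iff) (metis stream.collapse)+
qed

lemma sconst_set: "{sconst x} = (\<Inter>n. cyl (replicate n x))"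
  by (auto simp: mem_cyl_replicate left_word_eq_iff[of _ "sconst x"]) (use lessI in blast)

lemma sets_sconst: "{sconst x} \<in> sets left_words"
  unfolding sconst_set by (intro sets.countable_INT) (auto simp: sets_cyl)

lemma sconst_image: "(##) x ` {sconst x} = {sconst x}"
  by simp (subst siterate.code, simp)

lemma prob_algebra_left_wordsD:
  assumes "\<pi> \<in> space (prob_algebra left_words)"
  shows "prob_space \<pi>" "sets \<pi> = sets left_words" "space \<pi> = UNIV"
  using assms by (auto simp: space_prob_algebra dest: sets_eq_imp_space_eq)

text \<open>Cylinders form a \<open>\<pi>\<close>-system up to the empty set, because two cylinders are either nested
  or disjoint.\<close>

lemma word_mass_eqI:
  assumes "\<pi> \<in> space (prob_algebra left_words)" "\<rho> \<in> space (prob_algebra left_words)"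
    and eq: "\<And>w. word_mass \<pi> w = word_mass \<rho> w"
  shows "\<pi> = \<rho>"
proof -
  note \<pi> = prob_algebra_left_wordsD[OF assms(1)] and \<rho> = prob_algebra_left_wordsD[OF assms(2)]
  interpret \<pi>: prob_space \<pi> by fact
  interpret \<rho>: prob_space \<rho> by fact
  have r: "range cyl = range (sstart (UNIV :: bit set))"
    by (auto simp: cyl_eq_sstart image_iff) (metis rev_rev_ident)
  show ?thesis
  proof (rule measure_eqI_generator_eq[where E = "range cyl \<union> {{}}" and \<Omega> = UNIV and A = "\<lambda>_. UNIV"])
    show "Int_stable (range cyl \<union> {{}})"
      unfolding r using Int_stable_sstart[of "UNIV :: bit set"] by simp
    show "emeasure \<pi> X = emeasure \<rho> X" if "X \<in> range cyl \<union> {{}}" for X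
      using that eq by (auto simp: word_mass_def \<pi>.emeasure_eq_measure \<rho>.emeasure_eq_measure)
    have "sigma_sets UNIV (range cyl \<union> {{}}) = sigma_sets UNIV (range cyl)"
      by (intro antisym sigma_sets_mono sigma_sets_mono')
         (auto intro: sigma_sets.Empty sigma_sets.Basic)
    then show "sets \<pi> = sigma_sets UNIV (range cyl \<union> {{}})" "sets \<rho> = sigma_sets UNIV (range cyl \<union> {{}})"
      by (simp_all add: \<pi> \<rho> sets_left_words)
    show "range (\<lambda>_::nat. UNIV) \<subseteq> range cyl \<union> {{}}"
      using cyl_Nil by blast
  qed (auto simp: \<pi>.emeasure_eq_measure)
qed

lemma word_mass_Nil: "prob_space \<pi> \<Longrightarrow> space \<pi> = UNIV \<Longrightarrow> word_mass \<pi> [] = 1"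
  using prob_space.prob_space[of \<pi>] by (simp add: word_mass_def)

lemma word_mass_Cons:
  assumes "\<pi> \<in> space (prob_algebra left_words)"
  shows "word_mass \<pi> w = word_mass \<pi> (x # w) + word_mass \<pi> (opp x # w)"
proof -
  note \<pi> = prob_algebra_left_wordsD[OF assms]
  interpret prob_space \<pi> by fact
  have "cyl w = cyl (x # w) \<union> cyl (opp x # w)"
    using eq_or_opp by (auto simp: cyl_Cons)
  moreover have "cyl (x # w) \<inter> cyl (opp x # w) = {}"
    by (auto simp: cyl_Cons)
  ultimately show ?thesis
    unfolding word_mass_def using \<pi> by (subst finite_measure_Union[symmetric]) (auto simp: sets_cyl)
qed

lemma word_mass_replicate_limit:
  assumes "\<pi> \<in> space (prob_algebra left_words)"
  shows "(\<lambda>n. word_mass \<pi> (replicate n x)) \<longlonglongrightarrow> measure \<pi> {sconst x}"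
proof -
  note \<pi> = prob_algebra_left_wordsD[OF assms]
  interpret prob_space \<pi> by fact
  have "decseq (\<lambda>n. cyl (replicate n x))"
    by (auto simp: decseq_def mem_cyl_replicate)
  then show ?thesis
    unfolding word_mass_def sconst_set
    by (intro finite_Lim_measure_decseq) (auto simp: \<pi> sets_cyl)
qed

section \<open>One step of the chain\<close>

lemma pmf_opp: "pmf p (opp x) = 1 - pmf p x"
proof -
  have "(\<Sum>l\<in>{x, opp x}. pmf p l) = 1"
    unfolding UNIV_bit[of x, symmetric] by (simp add: sum_pmf_eq_1)
  then show ?thesis by simp
qed

lemma emeasure_vlmc_kernel:
  assumes "A \<in> sets left_words"
  shows "emeasure (vlmc_kernel q U) A
    = ennreal (pmf (q (pref U)) x) * indicator A (x ## U)
    + ennreal (pmf (q (pref U)) (opp x)) * indicator A (opp x ## U)"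
proof -
  have "(\<lambda>l. l ## U) \<in> measure_pmf (q (pref U)) \<rightarrow>\<^sub>M left_words"
    by simp
  then have "emeasure (vlmc_kernel q U) A = (\<integral>\<^sup>+l. indicator A (l ## U) \<partial>measure_pmf (q (pref U)))"
    unfolding vlmc_kernel_def using assms
    by (simp add: nn_integral_distr flip: nn_integral_indicator)
  also have "\<dots> = (\<Sum>l\<in>{x, opp x}. indicator A (l ## U) * ennreal (pmf (q (pref U)) l))"
    using eq_or_opp by (intro nn_integral_measure_pmf_support) auto
  also have "\<dots> = indicator A (x ## U) * ennreal (pmf (q (pref U)) x)
      + indicator A (opp x ## U) * ennreal (pmf (q (pref U)) (opp x))"
    by (simp only: sum.insert sum.empty finite.intros singleton_iff empty_iff opp_neq
        not_False_eq_True add_0_right)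
  finally show ?thesis
    by (simp only: mult.commute)
qed

lemma stationaryD:
  assumes "stationary q \<pi>"
  shows "\<pi> \<in> space (prob_algebra left_words)" "\<pi> \<bind> vlmc_kernel q = \<pi>"
  using assms by (auto simp: stationary_def)

lemma emeasure_step:
  assumes "\<pi> \<in> space (prob_algebra left_words)" "A \<in> sets left_words"
  shows "emeasure (\<pi> \<bind> vlmc_kernel q) A = (\<integral>\<^sup>+U. emeasure (vlmc_kernel q U) A \<partial>\<pi>)"
  by (rule emeasure_bind_prob_algebra[OF assms(1) measurable_vlmc_kernel assms(2)])

lemma step_in_prob_algebra:
  assumes "\<pi> \<in> space (prob_algebra left_words)"
  shows "\<pi> \<bind> vlmc_kernel q \<in> space (prob_algebra left_words)"
  by (auto simp: space_prob_algebra intro: prob_space_bind'[OF assms measurable_vlmc_kernel]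
      simp: sets_bind'[OF assms measurable_vlmc_kernel])

lemma stationaryI:
  assumes \<pi>: "\<pi> \<in> space (prob_algebra left_words)"
    and eq: "\<And>A. A \<in> sets left_words \<Longrightarrow> (\<integral>\<^sup>+U. emeasure (vlmc_kernel q U) A \<partial>\<pi>) = emeasure \<pi> A"
  shows "stationary q \<pi>"
  unfolding stationary_def
proof (intro conjI measure_eqI)
  show s: "sets (\<pi> \<bind> vlmc_kernel q) = sets \<pi>"
    using prob_algebra_left_wordsD(2)[OF step_in_prob_algebra[OF \<pi>]] prob_algebra_left_wordsD(2)[OF \<pi>]
    by simp
  show "emeasure (\<pi> \<bind> vlmc_kernel q) A = emeasure \<pi> A" if "A \<in> sets (\<pi> \<bind> vlmc_kernel q)" for A
    using that s prob_algebra_left_wordsD(2)[OF \<pi>] by (simp add: emeasure_step[OF \<pi>] eq)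
qed (fact \<pi>)

text \<open>A word of \<open>(##) l ` B\<close> can only be reached in one step by appending \<open>l\<close> to a word of \<open>B\<close>.  All
  transition probabilities enter the study of stationary laws through this rule.\<close>

lemma stationary_append:
  assumes st: "stationary q \<pi>" and B: "B \<in> sets left_words" and c: "\<And>U. U \<in> B \<Longrightarrow> pref U = c"
  shows "measure \<pi> ((##) l ` B) = pmf (q c) l * measure \<pi> B"
proof -
  note \<pi> = prob_algebra_left_wordsD[OF stationaryD(1)[OF st]]
  interpret prob_space \<pi> by fact
  have K: "emeasure (vlmc_kernel q U) ((##) l ` B) = ennreal (pmf (q c) l) * indicator B U" for U
  proof -
    have "emeasure (vlmc_kernel q U) ((##) l ` B) = ennreal (pmf (q (pref U)) l) * indicator B U"
      unfolding emeasure_vlmc_kernel[OF sets_Stream_image[OF B], where x = l]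
      by (auto simp: indicator_def image_iff)
    also have "\<dots> = ennreal (pmf (q c) l) * indicator B U"
      using c[of U] by (auto simp: indicator_def)
    finally show ?thesis .
  qed
  have "emeasure \<pi> ((##) l ` B) = (\<integral>\<^sup>+U. ennreal (pmf (q c) l) * indicator B U \<partial>\<pi>)"
    using emeasure_step[OF stationaryD(1)[OF st] sets_Stream_image[OF B], of q l] stationaryD(2)[OF st]
    by (simp add: K)
  also have "\<dots> = ennreal (pmf (q c) l) * emeasure \<pi> B"
    using B \<pi> by (simp add: nn_integral_cmult_indicator)
  finally show ?thesis
    by (simp add: emeasure_eq_measure flip: ennreal_mult)
qed

text \<open>Shift invariance: whatever letter is appended, forgetting it recovers the previous word.\<close>

lemma stationary_snoc_sum:
  assumes st: "stationary q \<pi>"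
  shows "word_mass \<pi> w = word_mass \<pi> (w @ [x]) + word_mass \<pi> (w @ [opp x])"
proof -
  note \<pi> = prob_algebra_left_wordsD[OF stationaryD(1)[OF st]]
  interpret prob_space \<pi> by fact
  let ?A = "stl -` cyl w"
  have A: "?A \<in> sets left_words"
    unfolding stl_vimage_cyl by (intro sets.Un sets_cyl)
  have K: "emeasure (vlmc_kernel q U) ?A = indicator (cyl w) U" for U
  proof -
    have "emeasure (vlmc_kernel q U) ?A
        = (ennreal (pmf (q (pref U)) x) + ennreal (pmf (q (pref U)) (opp x))) * indicator (cyl w) U"
      unfolding emeasure_vlmc_kernel[OF A, where x = x] by (simp add: indicator_def)
    also have "ennreal (pmf (q (pref U)) x) + ennreal (pmf (q (pref U)) (opp x)) = 1"
      by (simp add: pmf_opp pmf_le_1 flip: ennreal_plus)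
    finally show ?thesis by simp
  qed
  have "emeasure \<pi> ?A = emeasure \<pi> (cyl w)"
    using emeasure_step[OF stationaryD(1)[OF st] A, of q] stationaryD(2)[OF st]
    by (simp add: K \<pi> sets_cyl)
  moreover have "?A = cyl (w @ [x]) \<union> cyl (w @ [opp x])"
    unfolding stl_vimage_cyl by (cases x) auto
  moreover have "cyl (w @ [x]) \<inter> cyl (w @ [opp x]) = {}"
    by (auto simp: cyl_snoc)
  ultimately show ?thesis
    unfolding word_mass_def using \<pi>
    by (subst finite_measure_Union[symmetric]) (auto simp: sets_cyl emeasure_eq_measure)
qed

section \<open>Stationary masses of words\<close>

lemma casc_1 [simp]: "casc q x 1 = 1" "casc q x (Suc 0) = 1"
  by (simp_all add: casc_def)

lemma casc_Suc: "n \<ge> 1 \<Longrightarrow> casc q x (Suc n) = casc q x n * pmf (q (Fin_leaf x n)) x"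
  by (simp add: casc_def prod.atLeastLessThan_Suc)

lemma casc_nonneg: "0 \<le> casc q x n"
  by (simp add: casc_def prod_nonneg)

lemma \<Theta>_ge_1:
  assumes "\<Theta>_converges q x"
  shows "\<Theta> q x \<ge> 1"
  using sum_le_suminf[of "\<lambda>n. casc q x (Suc n)" "{0}"] assms
  by (simp add: \<Theta>_def \<Theta>_converges_def casc_nonneg)

lemma pref_cyl:
  assumes "U \<in> cyl (u @ opp x # replicate n x)" "n \<ge> 1"
  shows "pref U = Fin_leaf x n"
proof -
  obtain V where "U = rev (u @ opp x # replicate n x) @- V"
    using assms(1) by (auto simp: cyl_def)
  then have "U = replicate n x @- (opp x ## (rev u @- V))"
    by simp
  then show ?thesis
    using pref_run[OF assms(2) opp_neq(2)] by simp
qed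

lemma word_mass_snoc:
  assumes "stationary q \<pi>" "n \<ge> 1"
  shows "word_mass \<pi> ((u @ opp x # replicate n x) @ [l])
    = pmf (q (Fin_leaf x n)) l * word_mass \<pi> (u @ opp x # replicate n x)"
  unfolding word_mass_def cyl_snoc
  using assms by (intro stationary_append sets_cyl pref_cyl)

text \<open>The only predecessor of a constant word is that word itself.\<close>

lemma mass_sconst:
  assumes "stationary q \<pi>"
  shows "measure \<pi> {sconst x} = pmf (q (Inf_leaf x)) x * measure \<pi> {sconst x}"
  using stationary_append[OF assms sets_sconst[of x], of "Inf_leaf x" x]
  unfolding sconst_image by simp

lemma mass_sconst_eq_0:
  assumes "stationary q \<pi>" "pmf (q (Inf_leaf x)) x \<noteq> 1"
  shows "measure \<pi> {sconst x} = 0"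
  using mass_sconst[OF assms(1), of x] assms(2) by simp

text \<open>The two frequencies agree because \<open>\<pi>(x) - \<pi>(xx)\<close> is \<open>\<pi>(yx)\<close> by additivity and \<open>\<pi>(xy)\<close> by shift
  invariance.\<close>

lemma word_mass_change:
  assumes "stationary q \<pi>"
  shows "word_mass \<pi> [opp x, x] = word_mass \<pi> [x, opp x]"
  using word_mass_Cons[OF stationaryD(1)[OF assms], of "[x]" x] stationary_snoc_sum[OF assms, of "[x]" x]
  by simp

lemma word_mass_change_10:
  assumes "stationary q \<pi>"
  shows "word_mass \<pi> [opp x, x] = word_mass \<pi> [1, 0]"
  using word_mass_change[OF assms, of 0] by (cases x) auto

text \<open>Along a run the context is \<open>x\<^sup>n y\<close> with \<open>n\<close> increasing, so the transition probabilities
  multiply up to \<open>\<P>\<^sub>x\<close>.\<close>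

lemma word_mass_run:
  assumes st: "stationary q \<pi>"
  shows "word_mass \<pi> (opp x # replicate (Suc n) x) = word_mass \<pi> [1, 0] * casc q x (Suc n)"
proof (induction n)
  case 0
  then show ?case
    using word_mass_change_10[OF st] by simp
next
  case (Suc n)
  have "word_mass \<pi> (opp x # replicate (Suc (Suc n)) x)
      = pmf (q (Fin_leaf x (Suc n))) x * word_mass \<pi> (opp x # replicate (Suc n) x)"
    using word_mass_snoc[OF st, of "Suc n" "[]" x x] by (simp add: replicate_append_same)
  then show ?case
    using Suc by (simp add: casc_Suc)
qed

lemma word_mass_replicate:
  assumes st: "stationary q \<pi>"
  shows "word_mass \<pi> (replicate (Suc n) x)
    = word_mass \<pi> [x] - word_mass \<pi> [1, 0] * (\<Sum>k<n. casc q x (Suc k))"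
proof (induction n)
  case (Suc n)
  have "word_mass \<pi> (replicate (Suc n) x)
      = word_mass \<pi> (x # replicate (Suc n) x) + word_mass \<pi> (opp x # replicate (Suc n) x)"
    by (rule word_mass_Cons[OF stationaryD(1)[OF st]])
  then show ?case
    unfolding word_mass_run[OF st] using Suc by (simp add: algebra_simps)
qed simp

lemma stationary_comb_formulae:
  assumes st: "stationary q \<pi>"
  shows "comb_formulae q \<pi>"
proof -
  have run: "word_mass \<pi> (opp x # replicate n x) = word_mass \<pi> [1, 0] * casc q x n" if "n \<ge> 1" for n x
    using word_mass_run[OF st, of x "n - 1"] that by simp
  have rep: "word_mass \<pi> (replicate n x) = word_mass \<pi> [x] - word_mass \<pi> [1, 0] * (\<Sum>k=1..<n. casc q x k)"
    if "n \<ge> 2" for n x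
  proof -
    have "(\<Sum>k=1..<n. casc q x k) = (\<Sum>k<n - 1. casc q x (Suc k))"
      using that by (intro sum.reindex_bij_witness[of _ Suc "\<lambda>k. k - 1"]) auto
    then show ?thesis
      using word_mass_replicate[OF st, of "n - 1" x] that by simp
  qed
  show ?thesis
    unfolding comb_formulae_def
    using run[of _ 0] run[of _ 1] rep word_mass_change[OF st, of 0] by simp
qed

text \<open>Splitting the words ending with \<open>x\<close> by the length of their last run: the finite runs contribute
  \<open>\<pi>(10) \<P>\<^sub>x(n)\<close> each, and the rest is the mass of the constant word.\<close>

lemma sums_casc:
  assumes st: "stationary q \<pi>"
  shows "(\<lambda>n. word_mass \<pi> [1, 0] * casc q x (Suc n)) sums (word_mass \<pi> [x] - measure \<pi> {sconst x})"
proof -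
  have "(\<lambda>n. word_mass \<pi> [x] - word_mass \<pi> (replicate (Suc n) x))
      \<longlonglongrightarrow> word_mass \<pi> [x] - measure \<pi> {sconst x}"
    by (intro tendsto_intros LIMSEQ_Suc word_mass_replicate_limit stationaryD(1)[OF st])
  then show ?thesis
    unfolding word_mass_replicate[OF st] sums_def by (simp add: sum_distrib_left)
qed

lemma converges_if_change:
  assumes st: "stationary q \<pi>" and "word_mass \<pi> [1, 0] \<noteq> 0"
  shows "\<Theta>_converges q x"
  using sums_summable[OF sums_casc[OF st, of x]] assms(2)
  by (simp add: \<Theta>_converges_def)

lemma word_mass_letter:
  assumes st: "stationary q \<pi>"
  shows "word_mass \<pi> [x] = measure \<pi> {sconst x} + word_mass \<pi> [1, 0] * \<Theta> q x"
proof (cases "word_mass \<pi> [1, 0] = 0")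
  case True
  then show ?thesis
    using sums_casc[OF st, of x] sums_unique2[OF sums_zero, of "word_mass \<pi> [x] - measure \<pi> {sconst x}"]
    by simp
next
  case False
  have "word_mass \<pi> [1, 0] * \<Theta> q x = word_mass \<pi> [x] - measure \<pi> {sconst x}"
    using sums_unique[OF sums_casc[OF st, of x]] converges_if_change[OF st False, of x]
    by (simp add: \<Theta>_def \<Theta>_converges_def suminf_mult)
  then show ?thesis by simp
qed

lemma word_mass_letters:
  assumes "\<pi> \<in> space (prob_algebra left_words)"
  shows "word_mass \<pi> [x] + word_mass \<pi> [opp x] = 1"
  using word_mass_Cons[OF assms, of "[]" x] word_mass_Nil[of \<pi>] prob_algebra_left_wordsD[OF assms]
  by simp

lemma total_mass:
  assumes st: "stationary q \<pi>"
  shows "measure \<pi> {sconst 0} + measure \<pi> {sconst 1} + word_mass \<pi> [1, 0] * (\<Theta> q 0 + \<Theta> q 1) = 1"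
  using word_mass_letters[OF stationaryD(1)[OF st], of 0]
  unfolding word_mass_letter[OF st] by (simp add: algebra_simps)

lemma word_last_run:
  fixes w :: "bit list"
  assumes "w \<noteq> []"
  obtains n x where "n \<ge> 1" "w = replicate n x" | n x u where "n \<ge> 1" "w = u @ opp x # replicate n x"
  using assms
proof (induction w arbitrary: thesis rule: list_nonempty_induct)
  case (single y)
  show ?case
    by (rule single.prems(1)[of 1 y]) simp_all
next
  case (cons y w)
  show ?case
  proof (rule cons.IH)
    fix n x assume n: "n \<ge> 1" "w = replicate n x"
    show thesis
    proof (cases "y = x")
      case True
      show thesis
        by (rule cons.prems(1)[of "Suc n" x]) (simp_all add: n True)
    next
      case False
      then have "y = opp x"
        using eq_or_opp by blast
      then show thesis
        by (intro cons.prems(2)[of n "[]" x]) (use n in auto)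
    qed
  next
    fix n x u assume "n \<ge> 1" "w = u @ opp x # replicate n x"
    then show thesis
      by (intro cons.prems(2)[of n "y # u" x]) simp_all
  qed
qed

text \<open>A word with both letters ends with some \<open>y x\<^sup>n\<close>, \<open>n \<ge> 1\<close>, which fixes the context; hence the mass
  of a word is reduced letter by letter to the masses of the constant words.\<close>

lemma stationary_eqI:
  assumes st: "stationary q \<pi>" "stationary q \<rho>"
    and eq: "\<And>x. measure \<pi> {sconst x} = measure \<rho> {sconst x}"
      "word_mass \<pi> [1, 0] = word_mass \<rho> [1, 0]"
  shows "\<pi> = \<rho>"
proof (rule word_mass_eqI)
  fix w
  have nil: "word_mass \<pi> [] = 1" "word_mass \<rho> [] = 1"
    using word_mass_Nil prob_algebra_left_wordsD[OF stationaryD(1)] st by blast+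
  have rep: "word_mass \<pi> (replicate n x) = word_mass \<rho> (replicate n x)" for n x
    using word_mass_replicate[OF st(1)] word_mass_replicate[OF st(2)]
      word_mass_letter[OF st(1)] word_mass_letter[OF st(2)] eq nil
    by (cases n) (simp_all only: replicate_0)
  show "word_mass \<pi> w = word_mass \<rho> w"
  proof (induction w rule: rev_induct)
    case (snoc l w)
    show ?case
    proof (cases "w = []")
      case True
      then show ?thesis
        using rep[of 1 l] by simp
    next
      case False
      then show ?thesis
      proof (cases rule: word_last_run)
        case (1 n x)
        have "word_mass \<pi> (w @ [x]) = word_mass \<rho> (w @ [x])"
          using rep[of "Suc n" x] by (simp add: 1 replicate_append_same)
        then show ?thesis
          using eq_or_opp[of l x] stationary_snoc_sum[OF st(1), of w x]
            stationary_snoc_sum[OF st(2), of w x] snoc.IH by auto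
      next
        case (2 n x u)
        then show ?thesis
          using word_mass_snoc[OF st(1) 2(1)] word_mass_snoc[OF st(2) 2(1)] snoc.IH by simp
      qed
    qed
  qed (simp add: nil)
qed (use st stationaryD in blast)+

section \<open>Mixtures\<close>

lemma mixture_in_prob_algebra:
  assumes \<mu>: "\<And>i. \<mu> i \<in> space (prob_algebra left_words)"
  shows "measure_pmf p \<bind> \<mu> \<in> space (prob_algebra left_words)"
proof -
  have p: "measure_pmf p \<in> space (prob_algebra (count_space UNIV))"
    by (simp add: space_prob_algebra prob_space_measure_pmf)
  have "\<mu> \<in> count_space UNIV \<rightarrow>\<^sub>M prob_algebra left_words"
    using \<mu> by simp
  from prob_space_bind'[OF p this] sets_bind'[OF p this] show ?thesis
    by (simp add: space_prob_algebra)
qed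

lemma nn_integral_mixture:
  assumes \<mu>: "\<And>i. \<mu> i \<in> space (prob_algebra left_words)"
    and f: "f \<in> borel_measurable left_words"
  shows "(\<integral>\<^sup>+U. f U \<partial>(measure_pmf p \<bind> \<mu>)) = (\<integral>\<^sup>+i. \<integral>\<^sup>+U. f U \<partial>\<mu> i \<partial>measure_pmf p)"
proof -
  have "\<mu> \<in> count_space UNIV \<rightarrow>\<^sub>M prob_algebra left_words"
    using \<mu> by simp
  from measurable_prob_algebraD[OF this] have "\<mu> \<in> measure_pmf p \<rightarrow>\<^sub>M subprob_algebra left_words"
    by simp
  then show ?thesis
    by (rule nn_integral_bind[OF f])
qed

lemma emeasure_mixture:
  assumes \<mu>: "\<And>i. \<mu> i \<in> space (prob_algebra left_words)" and A: "A \<in> sets left_words"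
  shows "emeasure (measure_pmf p \<bind> \<mu>) A = (\<integral>\<^sup>+i. emeasure (\<mu> i) A \<partial>measure_pmf p)"
proof -
  have "A \<in> sets (measure_pmf p \<bind> \<mu>)" "\<And>i. A \<in> sets (\<mu> i)"
    using A prob_algebra_left_wordsD(2)[OF mixture_in_prob_algebra[of \<mu> p, OF \<mu>]]
      prob_algebra_left_wordsD(2)[OF \<mu>] by auto
  then show ?thesis
    using nn_integral_mixture[of \<mu> "indicator A" p, OF \<mu>] A by simp
qed

lemma measurable_emeasure_kernel:
  assumes "A \<in> sets left_words"
  shows "(\<lambda>U. emeasure (vlmc_kernel q U) A) \<in> borel_measurable left_words"
  using measurable_compose[OF measurable_prob_algebraD[OF measurable_vlmc_kernel]
      measurable_emeasure_subprob_algebra[OF assms]] .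

lemma stationary_mixture:
  assumes \<mu>: "t \<noteq> 0 \<Longrightarrow> stationary q \<mu>" and \<nu>: "t \<noteq> 1 \<Longrightarrow> stationary q \<nu>" and t: "0 \<le> t" "t \<le> 1"
  shows "\<exists>\<pi>. stationary q \<pi> \<and>
    (\<forall>A\<in>sets left_words. measure \<pi> A = t * measure \<mu> A + (1 - t) * measure \<nu> A)"
proof (cases "t = 0 \<or> t = 1")
  case True
  then show ?thesis
  proof
    assume "t = 0"
    then show ?thesis
      using \<nu> by (intro exI[of _ \<nu>]) simp
  next
    assume "t = 1"
    then show ?thesis
      using \<mu> by (intro exI[of _ \<mu>]) simp
  qed
next
  case False
  then have st\<mu>: "stationary q \<mu>" and st\<nu>: "stationary q \<nu>"
    using \<mu> \<nu> by auto
  define m where "m b = (if b then \<mu> else \<nu>)" for b :: bool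
  have st: "stationary q (m b)" for b
    using st\<mu> st\<nu> by (simp add: m_def)
  note m = stationaryD(1)[OF st]
  define \<pi> where "\<pi> = measure_pmf (bernoulli_pmf t) \<bind> m"
  have \<pi>: "\<pi> \<in> space (prob_algebra left_words)"
    unfolding \<pi>_def by (rule mixture_in_prob_algebra[OF m])
  have "stationary q \<pi>"
  proof (rule stationaryI[OF \<pi>])
    fix A assume A: "A \<in> sets left_words"
    have "(\<integral>\<^sup>+U. emeasure (vlmc_kernel q U) A \<partial>m b) = emeasure (m b) A" for b
      using emeasure_step[OF m[of b] A, of q] stationaryD(2)[OF st] by simp
    then show "(\<integral>\<^sup>+U. emeasure (vlmc_kernel q U) A \<partial>\<pi>) = emeasure \<pi> A"
      unfolding \<pi>_def
      by (simp add: nn_integral_mixture[OF m measurable_emeasure_kernel[OF A]] emeasure_mixture[OF m A])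
  qed
  moreover have "measure \<pi> A = t * measure \<mu> A + (1 - t) * measure \<nu> A" if A: "A \<in> sets left_words" for A
  proof -
    interpret \<pi>: prob_space \<pi>
      using \<pi> by (rule prob_algebra_left_wordsD)
    interpret \<mu>: prob_space \<mu>
      using stationaryD(1)[OF st\<mu>] by (rule prob_algebra_left_wordsD)
    interpret \<nu>: prob_space \<nu>
      using stationaryD(1)[OF st\<nu>] by (rule prob_algebra_left_wordsD)
    have "emeasure \<pi> A = ennreal t * emeasure \<mu> A + ennreal (1 - t) * emeasure \<nu> A"
      unfolding \<pi>_def using t
      by (simp add: emeasure_mixture[OF m A] m_def mult.commute)
    also have "\<dots> = ennreal (t * measure \<mu> A + (1 - t) * measure \<nu> A)"
      using t
      by (simp add: \<mu>.emeasure_eq_measure \<nu>.emeasure_eq_measure ennreal_mult' ennreal_plus)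
    finally show ?thesis
      using t by (simp add: \<pi>.emeasure_eq_measure del: ennreal_plus)
  qed
  ultimately show ?thesis
    by blast
qed

text \<open>A constant word whose context reproduces its letter almost surely is an absorbing state.\<close>

lemma stationary_sconst:
  assumes "pmf (q (Inf_leaf x)) x = 1"
  shows "stationary q (return left_words (sconst x))"
proof (rule stationaryI)
  show "return left_words (sconst x) \<in> space (prob_algebra left_words)"
    by (simp add: space_prob_algebra prob_space_return)
  fix A assume A: "A \<in> sets left_words"
  have "x ## sconst x = sconst x"
    using sconst_image[of x] by simp
  then have "emeasure (vlmc_kernel q (sconst x)) A = indicator A (sconst x)"
    unfolding emeasure_vlmc_kernel[OF A, where x = x] using assms by (simp add: pmf_opp)
  then show "(\<integral>\<^sup>+U. emeasure (vlmc_kernel q U) A \<partial>return left_words (sconst x))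
      = emeasure (return left_words (sconst x)) A"
    using A by (simp add: nn_integral_return measurable_emeasure_kernel)
qed

section \<open>Alternating renewal words\<close>

lemma nn_integral_bit_nat:
  fixes f :: "bit \<times> nat \<Rightarrow> ennreal"
  shows "(\<integral>\<^sup>+z. f z \<partial>count_space UNIV) = (\<Sum>n. f (0, n)) + (\<Sum>n. f (1, n))"
proof -
  have "(\<integral>\<^sup>+z. f z \<partial>count_space UNIV) = (\<integral>\<^sup>+x. \<integral>\<^sup>+n. f (x, n) \<partial>count_space UNIV \<partial>count_space UNIV)"
    by (rule nn_integral_fst_count_space[symmetric])
  also have "\<dots> = (\<Sum>x\<in>{0, opp 0}. \<integral>\<^sup>+n. f (x, n) \<partial>count_space UNIV)"
    unfolding UNIV_bit[of 0, symmetric] by (rule nn_integral_count_space_finite) simp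
  finally show ?thesis
    by (simp add: nn_integral_count_space_nat)
qed

lemma suminf_split_head_ennreal:
  fixes f :: "nat \<Rightarrow> ennreal"
  shows "(\<Sum>n. f n) = f 0 + (\<Sum>n. f (Suc n))"
  using sums_unique[OF sums_Suc[OF summable_sums[OF summableI, of "\<lambda>n. f (Suc n)"]]]
  by (simp add: add.commute)

text \<open>The law of a complete run of \<open>x\<close>, where the value \<open>n\<close> stands for length \<open>n + 1\<close>: the run reaches
  length \<open>n + 1\<close> but not \<open>n + 2\<close>.  The masses add up to \<open>1\<close> exactly if \<open>\<P>\<^sub>x\<close> tends to \<open>0\<close>.\<close>

definition run_length :: "(leaf \<Rightarrow> bit pmf) \<Rightarrow> bit \<Rightarrow> nat pmf" where
  "run_length q x = embed_pmf (\<lambda>n. casc q x (Suc n) - casc q x (Suc (Suc n)))"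

definition pick :: "bit \<Rightarrow> nat \<times> nat \<Rightarrow> nat" where
  "pick x p = (if x = 0 then fst p else snd p)"

text \<open>The word whose last run consists of \<open>n + 1\<close> letters \<open>x\<close>, the lengths of the earlier runs being
  supplied by \<open>\<omega>\<close>.  Each run consumes a pair of lengths, one for each letter, of which only the one for
  its own letter is read; thus one sequence of identically distributed pairs serves the two laws
  of run lengths.\<close>

primcorec runs :: "bit \<Rightarrow> nat \<Rightarrow> (nat \<times> nat) stream \<Rightarrow> bit stream" where
  "shd (runs x n \<omega>) = x"
| "stl (runs x n \<omega>) = (case n of
      0 \<Rightarrow> runs (opp x) (pick (opp x) (shd \<omega>)) (stl \<omega>)
    | Suc m \<Rightarrow> runs x m \<omega>)"

lemma runs_0: "runs x 0 \<omega> = x ## runs (opp x) (pick (opp x) (shd \<omega>)) (stl \<omega>)"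
  and runs_Suc: "runs x (Suc n) \<omega> = x ## runs x n \<omega>"
  by (simp_all add: runs.code)

definition run_lengths :: "(leaf \<Rightarrow> bit pmf) \<Rightarrow> (nat \<times> nat) stream measure" where
  "run_lengths q = stream_space (measure_pmf (pair_pmf (run_length q 0) (run_length q 1)))"

definition runs_law :: "(leaf \<Rightarrow> bit pmf) \<Rightarrow> bit \<Rightarrow> nat \<Rightarrow> left_word measure" where
  "runs_law q x n = distr (run_lengths q) left_words (runs x n)"

text \<open>The run preceding the last one is not empty, so the last one is maximal.\<close>

lemma pref_runs: "pref (runs x n \<omega>) = Fin_leaf x (Suc n)"
proof -
  have "\<exists>V. runs x n \<omega> = replicate (Suc n) x @- (opp x ## V)"
  proof (induction n)
    case 0
    show ?case
      by (simp add: runs_0[of x] runs.code[of "opp x"])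
  qed (auto simp: runs_Suc)
  then show ?thesis
    using pref_run[of "Suc n" x "opp x"] by auto
qed

lemma measurable_runs [measurable]: "runs x n \<in> run_lengths q \<rightarrow>\<^sub>M left_words"
proof -
  have "(\<lambda>\<omega>. runs x n \<omega> !! i) \<in> run_lengths q \<rightarrow>\<^sub>M count_space UNIV" for i
  proof (induction i arbitrary: x n)
    case (Suc i)
    show ?case
    proof (cases n)
      case 0
      have [measurable]: "(\<lambda>\<omega>. pick (opp x) (shd \<omega>)) \<in> run_lengths q \<rightarrow>\<^sub>M count_space UNIV"
        unfolding run_lengths_def by (rule measurable_compose[OF measurable_shd]) simp
      have [measurable]: "stl \<in> run_lengths q \<rightarrow>\<^sub>M run_lengths q"
        unfolding run_lengths_def by measurable
      have "(\<lambda>\<omega>. runs (opp x) (pick (opp x) (shd \<omega>)) (stl \<omega>) !! i) \<in> run_lengths q \<rightarrow>\<^sub>M count_space UNIV"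
        by (rule measurable_compose_countable[where f = "\<lambda>k \<omega>. runs (opp x) k (stl \<omega>) !! i"])
           (auto intro: measurable_compose[OF _ Suc])
      then show ?thesis
        by (simp add: 0 runs_0)
    qed (simp add: runs_Suc Suc)
  qed simp
  then show ?thesis
    unfolding left_words_def by (rule measurable_stream_space2)
qed

lemma prob_space_run_lengths: "prob_space (run_lengths q)"
  unfolding run_lengths_def by (intro prob_space.prob_space_stream_space prob_space_measure_pmf)

lemma runs_law_in_prob_algebra: "runs_law q x n \<in> space (prob_algebra left_words)"
  unfolding runs_law_def space_prob_algebra
  by (auto intro: prob_space.prob_space_distr prob_space_run_lengths)

lemma emeasure_runs_law_Suc:
  assumes [measurable]: "A \<in> sets left_words"
  shows "emeasure (runs_law q x (Suc n)) A = emeasure (runs_law q x n) ((##) x -` A)"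
proof -
  have "(##) x -` A \<in> sets left_words"
    using measurable_sets[OF measurable_Stream_left_words assms] by simp
  then show ?thesis
    unfolding runs_law_def by (subst (1 2) emeasure_distr) (auto simp: runs_Suc vimage_def)
qed

lemma pmf_run_length:
  assumes conv: "\<Theta>_converges q x"
  shows "pmf (run_length q x) n = casc q x (Suc n) - casc q x (Suc (Suc n))"
  unfolding run_length_def
proof (rule pmf_embed_pmf)
  show nonneg: "0 \<le> casc q x (Suc k) - casc q x (Suc (Suc k))" for k
    using mult_left_le[of "pmf (q (Fin_leaf x (Suc k))) x" "casc q x (Suc k)"]
    by (simp add: casc_Suc casc_nonneg pmf_le_1)
  have "(\<lambda>k. casc q x (Suc k)) \<longlonglongrightarrow> 0"
    using conv summable_LIMSEQ_zero unfolding \<Theta>_converges_def by blast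
  from telescope_sums'[OF this] have "(\<lambda>k. casc q x (Suc k) - casc q x (Suc (Suc k))) sums 1"
    by simp
  then show "(\<integral>\<^sup>+k. ennreal (casc q x (Suc k) - casc q x (Suc (Suc k))) \<partial>count_space UNIV) = 1"
    using nonneg by (simp add: nn_integral_count_space_nat suminf_ennreal2 sums_iff)
qed

text \<open>Just after a change of letter the run that has been left is a complete one, so its length follows
  \<open>run_length\<close>.\<close>

lemma emeasure_runs_law_0:
  assumes A[measurable]: "A \<in> sets left_words" and conv: "\<Theta>_converges q x"
  shows "emeasure (runs_law q (opp x) 0) A
    = (\<Sum>n. ennreal (casc q x (Suc n) - casc q x (Suc (Suc n))) * emeasure (runs_law q x n) ((##) (opp x) -` A))"
proof -
  let ?L = "pair_pmf (run_length q 0) (run_length q 1)"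
  have A'[measurable]: "(##) (opp x) -` A \<in> sets left_words"
    using measurable_sets[OF measurable_Stream_left_words A] by simp
  have fm: "(\<lambda>\<omega>. indicator A (runs (opp x) 0 \<omega>) :: ennreal) \<in> borel_measurable (run_lengths q)"
    by measurable
  have "emeasure (runs_law q (opp x) 0) A = (\<integral>\<^sup>+\<omega>. indicator A (runs (opp x) 0 \<omega>) \<partial>run_lengths q)"
    unfolding runs_law_def by (simp add: nn_integral_distr flip: nn_integral_indicator)
  also have "\<dots> = (\<integral>\<^sup>+p. \<integral>\<^sup>+\<omega>. indicator A (runs (opp x) 0 (p ## \<omega>)) \<partial>run_lengths q \<partial>measure_pmf ?L)"
    using fm unfolding run_lengths_def
    by (intro prob_space.nn_integral_stream_space prob_space_measure_pmf) simp
  also have "\<dots> = (\<integral>\<^sup>+p. emeasure (runs_law q x (pick x p)) ((##) (opp x) -` A) \<partial>measure_pmf ?L)"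
    unfolding runs_law_def
    by (simp add: nn_integral_distr runs_0 indicator_def flip: nn_integral_indicator)
  also have "\<dots> = (\<integral>\<^sup>+n. emeasure (runs_law q x n) ((##) (opp x) -` A) \<partial>measure_pmf (map_pmf (pick x) ?L))"
    by simp
  also have "map_pmf (pick x) ?L = run_length q x"
    by (cases x) (simp_all add: pick_def[abs_def] map_fst_pair_pmf map_snd_pair_pmf)
  also have "(\<integral>\<^sup>+n. emeasure (runs_law q x n) ((##) (opp x) -` A) \<partial>measure_pmf (run_length q x))
      = (\<Sum>n. ennreal (pmf (run_length q x) n) * emeasure (runs_law q x n) ((##) (opp x) -` A))"
    by (simp add: nn_integral_measure_pmf nn_integral_count_space_nat)
  finally show ?thesis
    by (simp add: pmf_run_length[OF conv])
qed

text \<open>One step of the chain prolongs the last run or completes it and starts a run of the other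
  letter.\<close>

lemma step_runs_law:
  assumes A[measurable]: "A \<in> sets left_words"
  shows "(\<integral>\<^sup>+U. emeasure (vlmc_kernel q U) A \<partial>runs_law q x n)
    = ennreal (pmf (q (Fin_leaf x (Suc n))) x) * emeasure (runs_law q x (Suc n)) A
    + ennreal (1 - pmf (q (Fin_leaf x (Suc n))) x) * emeasure (runs_law q x n) ((##) (opp x) -` A)"
proof -
  let ?p = "\<lambda>l. ennreal (pmf (q (Fin_leaf x (Suc n))) l)"
  have A'[measurable]: "(##) l -` A \<in> sets left_words" for l
    using measurable_sets[OF measurable_Stream_left_words A] by simp
  have [measurable]: "(\<lambda>U. emeasure (vlmc_kernel q U) A) \<in> borel_measurable left_words"
    by (rule measurable_emeasure_kernel[OF A])
  have "(\<integral>\<^sup>+U. emeasure (vlmc_kernel q U) A \<partial>runs_law q x n)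
      = (\<integral>\<^sup>+U. ?p x * indicator ((##) x -` A) U + ?p (opp x) * indicator ((##) (opp x) -` A) U \<partial>runs_law q x n)"
  proof -
    have "emeasure (vlmc_kernel q (runs x n \<omega>)) A = ?p x * indicator ((##) x -` A) (runs x n \<omega>)
        + ?p (opp x) * indicator ((##) (opp x) -` A) (runs x n \<omega>)" for \<omega>
      by (simp add: emeasure_vlmc_kernel[OF A, where x = x] pref_runs indicator_vimage)
    then show ?thesis
      unfolding runs_law_def by (simp add: nn_integral_distr)
  qed
  also have "\<dots> = ?p x * emeasure (runs_law q x n) ((##) x -` A)
      + ?p (opp x) * emeasure (runs_law q x n) ((##) (opp x) -` A)"
    using prob_algebra_left_wordsD(2)[OF runs_law_in_prob_algebra[of q x n]]
    by (simp add: nn_integral_add nn_integral_cmult_indicator A' cong: measurable_cong_sets)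
  finally show ?thesis
    by (simp add: emeasure_runs_law_Suc[OF A] pmf_opp)
qed

text \<open>Prolonged runs: the weight \<open>\<P>\<^sub>x(n)\<close> times the probability of prolonging is \<open>\<P>\<^sub>x(n+1)\<close>.  Completed
  runs: the weight \<open>\<P>\<^sub>x(n)\<close> times the probability of completing is the probability
  \<open>\<P>\<^sub>x(n) - \<P>\<^sub>x(n+1)\<close> of a complete run of length \<open>n\<close>, so together they produce the law of a word with
  a fresh run of length 1, with weight \<open>\<P>\<^sub>y(1) = 1\<close>.\<close>

lemma stationary_renewal:
  assumes conv: "\<Theta>_converges q 0" "\<Theta>_converges q 1"
  shows "\<exists>\<pi>. stationary q \<pi> \<and> measure \<pi> {sconst 0} = 0 \<and> measure \<pi> {sconst 1} = 0"
proof -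
  have conv': "\<Theta>_converges q x" for x
    using conv by (cases x) auto
  define S where "S = \<Theta> q 0 + \<Theta> q 1"
  have S: "S > 0"
    using \<Theta>_ge_1[OF conv(1)] \<Theta>_ge_1[OF conv(2)] by (simp add: S_def)
  define w where "w x n = casc q x (Suc n) / S" for x n
  have w: "w x n \<ge> 0" for x n
    using S by (simp add: w_def casc_nonneg)
  have w_sum: "(\<Sum>n. ennreal (w x n)) = ennreal (\<Theta> q x / S)" for x
    using w conv'[of x]
    by (simp add: suminf_ennreal2 w_def summable_divide \<Theta>_converges_def suminf_divide \<Theta>_def)
  define I where "I = embed_pmf (\<lambda>(x, n). w x n)"
  have "ennreal (\<Theta> q 0 / S) + ennreal (\<Theta> q 1 / S) = 1"
    using S \<Theta>_ge_1[OF conv(1)] \<Theta>_ge_1[OF conv(2)]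
    by (simp add: S_def flip: ennreal_plus add_divide_distrib)
  then have I: "pmf I (x, n) = w x n" for x n
    unfolding I_def using w
    by (subst pmf_embed_pmf) (auto simp: nn_integral_bit_nat w_sum)
  have int_I: "(\<integral>\<^sup>+z. f z \<partial>measure_pmf I)
      = (\<Sum>n. ennreal (w 0 n) * f (0, n)) + (\<Sum>n. ennreal (w 1 n) * f (1, n))" for f
    by (simp add: nn_integral_measure_pmf nn_integral_bit_nat I)
  \<comment> \<open>As in \<open>runs\<close>, the index \<open>(x, n)\<close> means a last run of \<open>n + 1\<close> letters \<open>x\<close>.\<close>
  define m where "m z = runs_law q (fst z) (snd z)" for z
  have m: "m z \<in> space (prob_algebra left_words)" for z
    unfolding m_def by (rule runs_law_in_prob_algebra)
  define \<pi> where "\<pi> = measure_pmf I \<bind> m"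
  have \<pi>: "\<pi> \<in> space (prob_algebra left_words)"
    unfolding \<pi>_def by (rule mixture_in_prob_algebra[OF m])
  have "stationary q \<pi>"
  proof (rule stationaryI[OF \<pi>])
    fix A assume A: "A \<in> sets left_words"
    define E where "E x n = emeasure (runs_law q x n) A" for x n
    \<comment> \<open>The part of the mass on words whose last run has length at least 2.\<close>
    define T where "T x = (\<Sum>n. ennreal (w x (Suc n)) * E x (Suc n))" for x
    have out: "(\<Sum>n. ennreal (w x n) * emeasure (m (x, n)) A) = ennreal (1 / S) * E x 0 + T x" for x
      unfolding T_def E_def m_def
      by (subst suminf_split_head_ennreal) (simp add: w_def)
    have step: "(\<Sum>n. ennreal (w x n) * (\<integral>\<^sup>+U. emeasure (vlmc_kernel q U) A \<partial>m (x, n)))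
        = T x + ennreal (1 / S) * E (opp x) 0" for x
    proof -
      let ?F = "\<lambda>n. ennreal (casc q x (Suc n) - casc q x (Suc (Suc n)))
        * emeasure (runs_law q x n) ((##) (opp x) -` A)"
      have "ennreal (w x n) * (\<integral>\<^sup>+U. emeasure (vlmc_kernel q U) A \<partial>m (x, n))
          = ennreal (w x (Suc n)) * E x (Suc n) + ennreal (1 / S) * ?F n" for n
      proof -
        let ?p = "pmf (q (Fin_leaf x (Suc n))) x"
        have "ennreal (w x n) * ennreal ?p = ennreal (w x (Suc n))"
          using w by (simp add: w_def casc_Suc flip: ennreal_mult)
        moreover have "ennreal (w x n) * ennreal (1 - ?p)
            = ennreal (1 / S) * ennreal (casc q x (Suc n) - casc q x (Suc (Suc n)))"
          using w[of x n] S pmf_le_1[of "q (Fin_leaf x (Suc n))" x]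
          by (simp add: w_def casc_Suc[of "Suc n"] algebra_simps diff_divide_distrib flip: ennreal_mult')
        ultimately show ?thesis
          by (simp add: m_def step_runs_law[OF A] E_def distrib_left flip: mult.assoc)
      qed
      then have "(\<Sum>n. ennreal (w x n) * (\<integral>\<^sup>+U. emeasure (vlmc_kernel q U) A \<partial>m (x, n)))
          = T x + ennreal (1 / S) * (\<Sum>n. ?F n)"
        by (simp add: T_def ennreal_suminf_cmult flip: suminf_add)
      then show ?thesis
        using emeasure_runs_law_0[OF A conv', of x] by (simp add: E_def)
    qed
    have "(\<integral>\<^sup>+U. emeasure (vlmc_kernel q U) A \<partial>\<pi>)
        = (T 0 + ennreal (1 / S) * E 1 0) + (T 1 + ennreal (1 / S) * E 0 0)"
      unfolding \<pi>_def nn_integral_mixture[OF m measurable_emeasure_kernel[OF A]] int_I step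
      by simp
    moreover have "emeasure \<pi> A
        = (ennreal (1 / S) * E 0 0 + T 0) + (ennreal (1 / S) * E 1 0 + T 1)"
      unfolding \<pi>_def emeasure_mixture[OF m A] int_I out ..
    ultimately show "(\<integral>\<^sup>+U. emeasure (vlmc_kernel q U) A \<partial>\<pi>) = emeasure \<pi> A"
      by (simp add: ac_simps)
  qed
  moreover have "measure \<pi> {sconst x} = 0" for x
  proof -
    have "runs y n \<omega> \<noteq> sconst x" for y n \<omega>
      using pref_runs[of y n \<omega>] by auto
    then have "emeasure (m z) {sconst x} = 0" for z
      unfolding m_def runs_law_def by (subst emeasure_distr) (auto simp: sets_sconst vimage_def)
    then have "emeasure \<pi> {sconst x} = 0"
      unfolding \<pi>_def by (simp add: emeasure_mixture[OF m sets_sconst])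
    then show ?thesis
      by (simp add: measure_def)
  qed
  ultimately show ?thesis
    by blast
qed

section \<open>The simplex of stationary measures\<close>

lemma \<Theta>_sum_pos:
  assumes "\<And>x. \<Theta>_converges q x"
  shows "\<Theta> q x + \<Theta> q (opp x) > 0"
  using \<Theta>_ge_1[OF assms, of x] \<Theta>_ge_1[OF assms, of "opp x"] by simp

lemma total_mass_letter:
  assumes st: "stationary q \<pi>"
  shows "measure \<pi> {sconst x} + measure \<pi> {sconst (opp x)}
    + word_mass \<pi> [opp x, x] * (\<Theta> q x + \<Theta> q (opp x)) = 1"
  unfolding word_mass_change_10[OF st]
  using total_mass[OF st] by (cases x) (simp_all add: ac_simps)

lemma no_change_if_divergent:
  assumes "stationary q \<pi>" "\<not> (\<forall>x. \<Theta>_converges q x)"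
  shows "word_mass \<pi> [1, 0] = 0"
  using converges_if_change[OF assms(1)] assms(2) by blast

text \<open>By the balance of masses the frequency of changes is determined by the masses of the constant
  words: it is \<open>0\<close> if a series diverges, and otherwise has the positive factor \<open>\<Theta>\<^sub>0 + \<Theta>\<^sub>1\<close>.\<close>

lemma stationary_unique:
  assumes st: "stationary q \<pi>" "stationary q \<rho>"
    and eq: "\<And>x. measure \<pi> {sconst x} = measure \<rho> {sconst x}"
  shows "\<pi> = \<rho>"
proof (rule stationary_eqI[OF st eq])
  show "word_mass \<pi> [1, 0] = word_mass \<rho> [1, 0]"
  proof (cases "\<forall>x. \<Theta>_converges q x")
    case True
    have "word_mass \<pi> [1, 0] * (\<Theta> q 0 + \<Theta> q 1) = word_mass \<rho> [1, 0] * (\<Theta> q 0 + \<Theta> q 1)"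
      using total_mass[OF st(1)] total_mass[OF st(2)] eq[of 0] eq[of 1] by linarith
    then show ?thesis
      using \<Theta>_sum_pos[of q 0] True by simp
  qed (simp add: no_change_if_divergent[OF st(1)] no_change_if_divergent[OF st(2)])
qed

text \<open>Peel off the point mass at \<open>0\<^sup>\<infinity>\<close>, then the one at \<open>1\<^sup>\<infinity>\<close>; what remains is a multiple of the
  renewal law.\<close>

lemma stationary_exists:
  fixes m :: "bit \<Rightarrow> real"
  assumes nonneg: "\<And>x. 0 \<le> m x" and le: "m 0 + m 1 \<le> 1"
    and absorb: "\<And>x. m x \<noteq> 0 \<Longrightarrow> pmf (q (Inf_leaf x)) x = 1"
    and conv: "m 0 + m 1 \<noteq> 1 \<Longrightarrow> \<forall>x. \<Theta>_converges q x"
  shows "\<exists>\<pi>. stationary q \<pi> \<and> (\<forall>x. measure \<pi> {sconst x} = m x)"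
proof -
  let ?\<delta> = "\<lambda>x. return left_words (sconst x)"
  have \<delta>: "stationary q (?\<delta> x)" if "m x \<noteq> 0" for x
    using that by (intro stationary_sconst absorb)
  have "sconst (0 :: bit) \<noteq> sconst 1"
    by (metis siterate.sel(1) zero_neq_one)
  then have \<delta>_mass: "measure (?\<delta> x) {sconst y} = (if x = y then 1 else 0)" for x y
    by (cases x; cases y) (auto simp: measure_return sets_sconst)
  \<comment> \<open>For \<open>m 0 = 1\<close> this is \<open>0 / 0 = 0\<close>, which is again a valid weight.\<close>
  define t where "t = m 1 / (1 - m 0)"
  have t: "0 \<le> t" "t \<le> 1" "(1 - m 0) * t = m 1"
    using nonneg[of 0] nonneg[of 1] le by (auto simp: t_def divide_le_eq_1)
  obtain \<sigma> where \<sigma>: "m 0 + m 1 \<noteq> 1 \<Longrightarrow> stationary q \<sigma> \<and> measure \<sigma> {sconst 0} = 0 \<and> measure \<sigma> {sconst 1} = 0"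
    using stationary_renewal[of q] conv by metis
  have t0: "m 1 \<noteq> 0" if "t \<noteq> 0"
    using that by (auto simp: t_def)
  have t1: "m 0 + m 1 \<noteq> 1 \<or> m 0 = 1" if "t \<noteq> 1"
    using that by (auto simp: t_def)
  \<comment> \<open>If \<open>m 0 = 1\<close> the second component gets weight \<open>0\<close>, and no stationary one need exist.\<close>
  have "\<exists>\<rho>. m 0 \<noteq> 1 \<longrightarrow> stationary q \<rho> \<and>
      (\<forall>A\<in>sets left_words. measure \<rho> A = t * measure (?\<delta> 1) A + (1 - t) * measure \<sigma> A)"
  proof (cases "m 0 = 1")
    case False
    then show ?thesis
      using stationary_mixture[of t q "?\<delta> 1" \<sigma>] t t0 t1 \<delta> \<sigma> by blast
  qed simp
  then obtain \<rho> where \<rho>: "m 0 \<noteq> 1 \<Longrightarrow> stationary q \<rho> \<and>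
      (\<forall>A\<in>sets left_words. measure \<rho> A = t * measure (?\<delta> 1) A + (1 - t) * measure \<sigma> A)"
    by blast
  obtain \<pi> where \<pi>: "stationary q \<pi>"
      "\<forall>A\<in>sets left_words. measure \<pi> A = m 0 * measure (?\<delta> 0) A + (1 - m 0) * measure \<rho> A"
    using stationary_mixture[of "m 0" q "?\<delta> 0" \<rho>] \<delta> \<rho> nonneg[of 0] nonneg[of 1] le by fastforce
  have \<sigma>0: "(1 - t) * measure \<sigma> {sconst x} = 0" if "m 0 \<noteq> 1" for x
  proof (cases "t = 1")
    case False
    then show ?thesis
      using \<sigma> t1 that by (cases x) auto
  qed simp
  have "measure \<pi> {sconst x} = m x" for x
  proof (cases "m 0 = 1")
    case True
    then have "m 1 = 0"
      using nonneg[of 1] le by simp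
    then show ?thesis
      using \<pi>(2) True by (cases x) (simp_all add: sets_sconst \<delta>_mass)
  next
    case False
    then have "measure \<rho> {sconst x} = t * (if x = 1 then 1 else 0)"
      using \<rho> \<sigma>0 by (cases x) (simp_all add: sets_sconst \<delta>_mass)
    then show ?thesis
      using \<pi>(2) t(3) by (cases x) (simp_all add: sets_sconst \<delta>_mass)
  qed
  with \<pi>(1) show ?thesis
    by blast
qed

lemma stationary_ex1:
  fixes m :: "bit \<Rightarrow> real"
  assumes "\<And>x. 0 \<le> m x" "m 0 + m 1 \<le> 1"
    and "\<And>x. m x \<noteq> 0 \<Longrightarrow> pmf (q (Inf_leaf x)) x = 1"
    and "m 0 + m 1 \<noteq> 1 \<Longrightarrow> \<forall>x. \<Theta>_converges q x"
  shows "\<exists>!\<pi>. stationary q \<pi> \<and> (\<forall>x. measure \<pi> {sconst x} = m x)"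
  using stationary_exists[of m q] assms stationary_unique[of q] by metis

text \<open>The pair \<open>(\<pi>(x), \<pi>(yx))\<close> is an affine function of \<open>(\<pi>(x\<^sup>\<infinity>), \<pi>(y\<^sup>\<infinity>))\<close> with determinant
  \<open>-1 / (\<Theta>\<^sub>0 + \<Theta>\<^sub>1)\<close>, so each pair determines the other.\<close>

lemma masses_iff:
  assumes st: "stationary q \<pi>" and conv: "\<And>x. \<Theta>_converges q x"
  shows "measure \<pi> {sconst x} = a \<and> measure \<pi> {sconst (opp x)} = b \<longleftrightarrow>
    word_mass \<pi> [x] = (a * \<Theta> q (opp x) + (1 - b) * \<Theta> q x) / (\<Theta> q x + \<Theta> q (opp x)) \<and>
    word_mass \<pi> [opp x, x] = (1 - a - b) / (\<Theta> q x + \<Theta> q (opp x))"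
proof -
  define S where "S = \<Theta> q x + \<Theta> q (opp x)"
  have S: "S > 0"
    using \<Theta>_sum_pos[of q x, OF conv] by (simp add: S_def)
  define A B c where "A = measure \<pi> {sconst x}" and "B = measure \<pi> {sconst (opp x)}"
    and "c = word_mass \<pi> [opp x, x]"
  have tot: "c * S = 1 - A - B"
    using total_mass_letter[OF st, of x] by (simp add: A_def B_def c_def S_def)
  have c: "c = (1 - A - B) / S"
    using tot S by (simp add: field_simps)
  have W: "word_mass \<pi> [x] = A + c * \<Theta> q x"
    using word_mass_letter[OF st, of x] word_mass_change_10[OF st, of x] by (simp add: A_def c_def)
  have "(word_mass \<pi> [x]) * S = A * \<Theta> q (opp x) + (1 - B) * \<Theta> q x"
    using tot unfolding W S_def by (simp add: algebra_simps) algebra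
  then have W': "word_mass \<pi> [x] = (A * \<Theta> q (opp x) + (1 - B) * \<Theta> q x) / S"
    using S by (simp add: field_simps)
  show ?thesis
    unfolding S_def[symmetric] A_def[symmetric] B_def[symmetric] c_def[symmetric]
  proof (intro iffI conjI; (elim conjE)?)
    assume W'': "word_mass \<pi> [x] = (a * \<Theta> q (opp x) + (1 - b) * \<Theta> q x) / S"
      and c': "c = (1 - a - b) / S"
    have "a + b = A + B"
      using c c' S by (simp add: field_simps)
    moreover have "a * \<Theta> q (opp x) + (1 - b) * \<Theta> q x = A * \<Theta> q (opp x) + (1 - B) * \<Theta> q x"
      using W' W'' S by simp
    ultimately have "(a - A) * S = 0"
      unfolding S_def by algebra
    then show "A = a" using S by simp
    with \<open>a + b = A + B\<close> show "B = b" by simp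
  qed (use W' c in auto)
qed

section \<open>Measures carried by the constant words\<close>

lemma sconst_mem_cyl: "sconst x \<in> cyl w \<longleftrightarrow> (\<forall>y\<in>set w. y = x)"
proof (induction w)
  case (Cons z w)
  have "sconst x !! length w = x"
    by (simp only: snth_siterate id_funpow id_apply)
  then show ?case
    using Cons by (auto simp only: cyl_Cons mem_Collect_eq list.set ball_simps)
qed simp

lemma measure_on_constants:
  assumes \<pi>: "\<pi> \<in> space (prob_algebra left_words)"
    and m: "measure \<pi> {sconst x} + measure \<pi> {sconst (opp x)} = 1" and A: "A \<in> sets left_words"
  shows "measure \<pi> A = measure \<pi> {sconst x} * indicator A (sconst x)
    + measure \<pi> {sconst (opp x)} * indicator A (sconst (opp x))"
proof -
  note p = prob_algebra_left_wordsD[OF \<pi>]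
  interpret prob_space \<pi> by fact
  have ne: "sconst x \<noteq> sconst (opp x)"
    by (metis siterate.sel(1) opp_neq(1))
  have s: "{sconst y} \<in> events" "A \<in> events" "{} \<in> events" for y
    using p A sets_sconst by auto
  have "prob ({sconst x} \<union> {sconst (opp x)}) = 1"
    using ne m s by (subst finite_measure_Union) auto
  moreover have "{sconst x} \<union> {sconst (opp x)} \<in> events"
    using s by (intro sets.Un)
  ultimately have "AE U in \<pi>. U \<in> {sconst x} \<union> {sconst (opp x)}"
    using prob_eq_1 by blast
  then have "prob A = prob (A \<inter> {sconst x} \<union> A \<inter> {sconst (opp x)})"
    using s by (intro finite_measure_eq_AE) auto
  also have "\<dots> = prob (A \<inter> {sconst x}) + prob (A \<inter> {sconst (opp x)})"
    using ne s by (intro finite_measure_Union) auto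
  finally show ?thesis
    by (auto simp: indicator_def)
qed

text \<open>A measure carried by the two constant words is determined by its two atoms, so it equals the
  stationary law that has the same atoms.\<close>

lemma stationary_on_constants:
  assumes \<pi>: "\<pi> \<in> space (prob_algebra left_words)"
    and m: "measure \<pi> {sconst 0} + measure \<pi> {sconst 1} = 1"
    and absorb: "\<And>x. measure \<pi> {sconst x} \<noteq> 0 \<Longrightarrow> pmf (q (Inf_leaf x)) x = 1"
  shows "stationary q \<pi>"
proof -
  obtain \<rho> where \<rho>: "stationary q \<rho>" "\<forall>x. measure \<rho> {sconst x} = measure \<pi> {sconst x}"
    using stationary_exists[of "\<lambda>x. measure \<pi> {sconst x}" q] m absorb by auto
  have "\<pi> = \<rho>"
  proof (rule word_mass_eqI[OF \<pi> stationaryD(1)[OF \<rho>(1)]])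
    show "word_mass \<pi> w = word_mass \<rho> w" for w
      unfolding word_mass_def
      using measure_on_constants[OF \<pi>, of 0 "cyl w"] m \<rho>(2) sets_cyl
        measure_on_constants[OF stationaryD(1)[OF \<rho>(1)], of 0 "cyl w"] by simp
  qed
  with \<rho>(1) show ?thesis by simp
qed

section \<open>The cases\<close>

lemma one_absorbing_divergent:
  assumes x: "pmf (q (Inf_leaf x)) x = 1" and y: "pmf (q (Inf_leaf (opp x))) (opp x) \<noteq> 1"
    and div: "\<not> (\<forall>x. \<Theta>_converges q x)"
  shows "(\<exists>!\<pi>. stationary q \<pi>) \<and>
    (\<forall>\<pi>\<in>space (prob_algebra left_words). stationary q \<pi> \<longleftrightarrow> measure \<pi> {sconst x} = 1)"
proof -
  have m: "measure \<pi> {sconst x} = 1" "measure \<pi> {sconst (opp x)} = 0" if st: "stationary q \<pi>" for \<pi>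
    using total_mass_letter[OF st, of x] mass_sconst_eq_0[OF st y] no_change_if_divergent[OF st div]
      word_mass_change_10[OF st, of x] by auto
  have uniq: "\<pi> = \<rho>" if "stationary q \<pi>" "stationary q \<rho>" for \<pi> \<rho>
  proof (rule stationary_unique[OF that])
    show "measure \<pi> {sconst z} = measure \<rho> {sconst z}" for z
      using m that eq_or_opp[of z x] by auto
  qed
  have "stationary q \<pi>" if \<pi>: "\<pi> \<in> space (prob_algebra left_words)" "measure \<pi> {sconst x} = 1" for \<pi>
  proof -
    interpret prob_space \<pi>
      using \<pi>(1) by (rule prob_algebra_left_wordsD)
    have "sconst x \<noteq> sconst (opp x)"
      by (metis siterate.sel(1) opp_neq(1))
    then have "prob {sconst x} + prob {sconst (opp x)} = prob ({sconst x} \<union> {sconst (opp x)})"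
      using prob_algebra_left_wordsD(2)[OF \<pi>(1)] sets_sconst
      by (intro finite_measure_Union[symmetric]) auto
    then have 0: "prob {sconst (opp x)} = 0"
      using \<pi>(2) prob_le_1[of "{sconst x} \<union> {sconst (opp x)}"] measure_nonneg[of \<pi> "{sconst (opp x)}"]
      by linarith
    show ?thesis
    proof (rule stationary_on_constants[OF \<pi>(1)])
      show "prob {sconst 0} + prob {sconst 1} = 1"
        using \<pi>(2) 0 by (cases x) auto
      show "pmf (q (Inf_leaf z)) z = 1" if "prob {sconst z} \<noteq> 0" for z
        using that 0 x eq_or_opp[of z x] by auto
    qed
  qed
  moreover have "\<exists>\<pi>. stationary q \<pi>"
    using stationary_sconst[of q x] x by blast
  ultimately show ?thesis
    using m uniq by blast
qed

lemma one_absorbing_convergent: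
  assumes x: "pmf (q (Inf_leaf x)) x = 1" and y: "pmf (q (Inf_leaf (opp x))) (opp x) \<noteq> 1"
    and conv: "\<forall>x. \<Theta>_converges q x" and a: "a \<in> {0..1}"
  shows "(\<exists>!\<pi>. stationary q \<pi> \<and> measure \<pi> {sconst x} = a) \<and>
    (\<forall>\<pi>. stationary q \<pi> \<longrightarrow>
       (measure \<pi> {sconst x} = a \<longleftrightarrow>
         word_mass \<pi> [x] = (a * \<Theta> q (opp x) + \<Theta> q x) / (\<Theta> q x + \<Theta> q (opp x)) \<and>
         word_mass \<pi> [opp x, x] = (1 - a) / (\<Theta> q x + \<Theta> q (opp x)) \<and>
         comb_formulae q \<pi>))"
proof -
  define m where "m z = (if z = x then a else 0)" for z
  have m: "(\<forall>z. measure \<pi> {sconst z} = m z) \<longleftrightarrow> measure \<pi> {sconst x} = a"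
    if "stationary q \<pi>" for \<pi>
    using mass_sconst_eq_0[OF that y] eq_or_opp[of _ x] unfolding m_def by (metis opp_neq(1))
  have "m 0 + m 1 = a"
    by (cases x) (auto simp: m_def)
  then have "\<exists>!\<pi>. stationary q \<pi> \<and> (\<forall>z. measure \<pi> {sconst z} = m z)"
    using a x conv by (intro stationary_ex1) (auto simp: m_def split: if_splits)
  then have "\<exists>!\<pi>. stationary q \<pi> \<and> measure \<pi> {sconst x} = a"
    using m by metis
  moreover have "measure \<pi> {sconst x} = a \<longleftrightarrow>
      word_mass \<pi> [x] = (a * \<Theta> q (opp x) + \<Theta> q x) / (\<Theta> q x + \<Theta> q (opp x)) \<and>
      word_mass \<pi> [opp x, x] = (1 - a) / (\<Theta> q x + \<Theta> q (opp x)) \<and>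
      comb_formulae q \<pi>" if st: "stationary q \<pi>" for \<pi>
    using masses_iff[OF st conv[rule_format], of x a 0] mass_sconst_eq_0[OF st y] stationary_comb_formulae[OF st]
    by simp
  ultimately show ?thesis
    by blast
qed

lemma no_absorbing:
  assumes p: "\<And>x. pmf (q (Inf_leaf x)) x \<noteq> 1"
  shows "((\<exists>\<pi>. stationary q \<pi>) \<longleftrightarrow> (\<forall>x. \<Theta>_converges q x)) \<and>
    ((\<forall>x. \<Theta>_converges q x) \<longrightarrow>
      (\<exists>!\<pi>. stationary q \<pi>) \<and>
      (\<forall>\<pi>. stationary q \<pi> \<longrightarrow>
         word_mass \<pi> [0] = \<Theta> q 0 / (\<Theta> q 0 + \<Theta> q 1) \<and>
         word_mass \<pi> [1, 0] = 1 / (\<Theta> q 0 + \<Theta> q 1) \<and>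
         comb_formulae q \<pi>))"
proof -
  have m: "measure \<pi> {sconst x} = 0" if "stationary q \<pi>" for \<pi> x
    using mass_sconst_eq_0[OF that p] .
  have "\<forall>x. \<Theta>_converges q x" if "stationary q \<pi>" for \<pi>
    using total_mass[OF that] m[OF that] no_change_if_divergent[OF that]
    by (metis add_0 mult_zero_left zero_neq_one)
  moreover have "\<exists>!\<pi>. stationary q \<pi>" if "\<forall>x. \<Theta>_converges q x"
    using stationary_ex1[of "\<lambda>_. 0" q] that m by (simp cong: conj_cong)
  moreover have "word_mass \<pi> [0] = \<Theta> q 0 / (\<Theta> q 0 + \<Theta> q 1) \<and>
      word_mass \<pi> [1, 0] = 1 / (\<Theta> q 0 + \<Theta> q 1)"
    if "stationary q \<pi>" "\<forall>x. \<Theta>_converges q x" for \<pi>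
    using masses_iff[OF that(1), of 0 0 0] that(2) m[OF that(1)] by simp
  ultimately show ?thesis
    using stationary_comb_formulae by blast
qed

text \<open>Since there are no changes of letter, the stationary laws live on the two constant words.  In the
  converse direction the masses of \<open>0\<^sup>n\<close> and \<open>1\<^sup>n\<close> give the two atoms in the limit, and these exhaust
  the total mass.\<close>

lemma two_absorbing_divergent:
  assumes p: "\<And>x. pmf (q (Inf_leaf x)) x = 1" and div: "\<not> (\<forall>x. \<Theta>_converges q x)"
    and a: "a \<in> {0..1}"
  shows "(\<exists>!\<pi>. stationary q \<pi> \<and> measure \<pi> {sconst 0} = a) \<and>
    (\<forall>\<pi>\<in>space (prob_algebra left_words).
       stationary q \<pi> \<and> measure \<pi> {sconst 0} = a \<longleftrightarrow>
         (\<forall>n\<ge>1. word_mass \<pi> (replicate n 0) = a) \<and>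
         (\<forall>n\<ge>1. word_mass \<pi> (replicate n 1) = 1 - a) \<and>
         (\<forall>w. 0 \<in> set w \<and> 1 \<in> set w \<longrightarrow> word_mass \<pi> w = 0))"
proof -
  define m where "m z = (if z = 0 then a else 1 - a)" for z :: bit
  have tot: "measure \<pi> {sconst 0} + measure \<pi> {sconst 1} = 1" if "stationary q \<pi>" for \<pi>
    using total_mass[OF that] no_change_if_divergent[OF that div] by simp
  have m: "(\<forall>z. measure \<pi> {sconst z} = m z) \<longleftrightarrow> measure \<pi> {sconst 0} = a"
    if "stationary q \<pi>" for \<pi>
  proof
    assume "measure \<pi> {sconst 0} = a"
    then have "measure \<pi> {sconst z} = m z" for z
      using tot[OF that] by (cases z) (auto simp: m_def)
    then show "\<forall>z. measure \<pi> {sconst z} = m z" by blast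
  qed (simp add: m_def)
  have "\<exists>!\<pi>. stationary q \<pi> \<and> (\<forall>z. measure \<pi> {sconst z} = m z)"
    using a p by (intro stationary_ex1) (auto simp: m_def)
  then have "\<exists>!\<pi>. stationary q \<pi> \<and> measure \<pi> {sconst 0} = a"
    using m by metis
  moreover have "stationary q \<pi> \<and> measure \<pi> {sconst 0} = a \<longleftrightarrow>
      (\<forall>n\<ge>1. word_mass \<pi> (replicate n 0) = a) \<and>
      (\<forall>n\<ge>1. word_mass \<pi> (replicate n 1) = 1 - a) \<and>
      (\<forall>w. 0 \<in> set w \<and> 1 \<in> set w \<longrightarrow> word_mass \<pi> w = 0)"
    if \<pi>: "\<pi> \<in> space (prob_algebra left_words)" for \<pi>
  proof (intro iffI)
    assume *: "stationary q \<pi> \<and> measure \<pi> {sconst 0} = a"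
    then have *: "measure \<pi> {sconst 0} = a" "measure \<pi> {sconst 1} = 1 - a"
      using tot[of \<pi>] by auto
    have "word_mass \<pi> w = a * indicator (cyl w) (sconst 0) + (1 - a) * indicator (cyl w) (sconst 1)" for w
      unfolding word_mass_def using measure_on_constants[OF \<pi>, of 0 "cyl w"] * sets_cyl by simp
    then show "(\<forall>n\<ge>1. word_mass \<pi> (replicate n 0) = a) \<and>
      (\<forall>n\<ge>1. word_mass \<pi> (replicate n 1) = 1 - a) \<and>
      (\<forall>w. 0 \<in> set w \<and> 1 \<in> set w \<longrightarrow> word_mass \<pi> w = 0)"
      by (auto simp: indicator_def sconst_mem_cyl)
  next
    assume *: "(\<forall>n\<ge>1. word_mass \<pi> (replicate n 0) = a) \<and>
      (\<forall>n\<ge>1. word_mass \<pi> (replicate n 1) = 1 - a) \<and>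
      (\<forall>w. 0 \<in> set w \<and> 1 \<in> set w \<longrightarrow> word_mass \<pi> w = 0)"
    have "measure \<pi> {sconst x} = m x" for x
    proof (rule LIMSEQ_unique[OF word_mass_replicate_limit[OF \<pi>]])
      have "\<forall>\<^sub>F n in sequentially. word_mass \<pi> (replicate n x) = m x"
        using eventually_ge_at_top[of 1] by eventually_elim (use * in \<open>cases x; simp add: m_def\<close>)
      then show "(\<lambda>n. word_mass \<pi> (replicate n x)) \<longlonglongrightarrow> m x"
        by (rule tendsto_eventually)
    qed
    then have "measure \<pi> {sconst 0} = a" "measure \<pi> {sconst 1} = 1 - a"
      by (simp_all add: m_def)
    then show "stationary q \<pi> \<and> measure \<pi> {sconst 0} = a"
      using stationary_on_constants[OF \<pi>] p by simp
  qed
  ultimately show ?thesis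
    by blast
qed

lemma two_absorbing_convergent:
  assumes p: "\<And>x. pmf (q (Inf_leaf x)) x = 1" and conv: "\<forall>x. \<Theta>_converges q x"
    and ab: "0 \<le> a" "0 \<le> b" "a + b \<le> 1"
  shows "(\<exists>!\<pi>. stationary q \<pi> \<and> measure \<pi> {sconst 0} = a \<and> measure \<pi> {sconst 1} = b) \<and>
    (\<forall>\<pi>. stationary q \<pi> \<longrightarrow>
       (measure \<pi> {sconst 0} = a \<and> measure \<pi> {sconst 1} = b \<longleftrightarrow>
         word_mass \<pi> [0] = (a * \<Theta> q 1 + (1 - b) * \<Theta> q 0) / (\<Theta> q 0 + \<Theta> q 1) \<and>
         word_mass \<pi> [1, 0] = (1 - a - b) / (\<Theta> q 0 + \<Theta> q 1) \<and>
         comb_formulae q \<pi>))"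
proof -
  define m where "m z = (if z = 0 then a else b)" for z :: bit
  have m: "(\<forall>z. measure \<pi> {sconst z} = m z) \<longleftrightarrow> measure \<pi> {sconst 0} = a \<and> measure \<pi> {sconst 1} = b" for \<pi>
    unfolding m_def by (metis bit_not_zero_iff zero_neq_one)
  have "\<exists>!\<pi>. stationary q \<pi> \<and> (\<forall>z. measure \<pi> {sconst z} = m z)"
    using ab p conv by (intro stationary_ex1) (auto simp: m_def)
  then have "\<exists>!\<pi>. stationary q \<pi> \<and> measure \<pi> {sconst 0} = a \<and> measure \<pi> {sconst 1} = b"
    unfolding m .
  then show ?thesis
    using masses_iff[OF _ conv[rule_format], of _ 0 a b] stationary_comb_formulae by simp
qed

lemma all_bit: "(\<forall>x. P x) \<longleftrightarrow> P 0 \<and> P (1 :: bit)"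
  by (metis bit_not_zero_iff)

theorem propositionB1:
  fixes q :: "leaf \<Rightarrow> bit pmf"
  shows
   "(pmf (q (Inf_leaf 0)) 0 \<noteq> 1 \<and> pmf (q (Inf_leaf 1)) 1 \<noteq> 1 \<longrightarrow>
      ((\<exists>\<pi>. stationary q \<pi>) \<longleftrightarrow> \<Theta>_converges q 0 \<and> \<Theta>_converges q 1) \<and>
      (\<Theta>_converges q 0 \<and> \<Theta>_converges q 1 \<longrightarrow>
        (\<exists>!\<pi>. stationary q \<pi>) \<and>
        (\<forall>\<pi>. stationary q \<pi> \<longrightarrow>
           word_mass \<pi> [0] = \<Theta> q 0 / (\<Theta> q 0 + \<Theta> q 1) \<and>
           word_mass \<pi> [1, 0] = 1 / (\<Theta> q 0 + \<Theta> q 1) \<and>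
           comb_formulae q \<pi>))) \<and>

    (pmf (q (Inf_leaf 0)) 0 = 1 \<and> pmf (q (Inf_leaf 1)) 1 \<noteq> 1 \<longrightarrow>
      (\<not> \<Theta>_converges q 0 \<or> \<not> \<Theta>_converges q 1 \<longrightarrow>
        (\<exists>!\<pi>. stationary q \<pi>) \<and>
        (\<forall>\<pi>\<in>space (prob_algebra left_words).
           stationary q \<pi> \<longleftrightarrow> measure \<pi> {sconst 0} = 1)) \<and>
      (\<Theta>_converges q 0 \<and> \<Theta>_converges q 1 \<longrightarrow>
        (\<forall>a\<in>{0..1}.
          (\<exists>!\<pi>. stationary q \<pi> \<and> measure \<pi> {sconst 0} = a) \<and>
          (\<forall>\<pi>. stationary q \<pi> \<longrightarrow>
             (measure \<pi> {sconst 0} = a \<longleftrightarrow>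
               word_mass \<pi> [0] = (a * \<Theta> q 1 + \<Theta> q 0) / (\<Theta> q 0 + \<Theta> q 1) \<and>
               word_mass \<pi> [1, 0] = (1 - a) / (\<Theta> q 0 + \<Theta> q 1) \<and>
               comb_formulae q \<pi>))))) \<and>

    (pmf (q (Inf_leaf 0)) 0 \<noteq> 1 \<and> pmf (q (Inf_leaf 1)) 1 = 1 \<longrightarrow>
      (\<not> \<Theta>_converges q 0 \<or> \<not> \<Theta>_converges q 1 \<longrightarrow>
        (\<exists>!\<pi>. stationary q \<pi>) \<and>
        (\<forall>\<pi>\<in>space (prob_algebra left_words).
           stationary q \<pi> \<longleftrightarrow> measure \<pi> {sconst 1} = 1)) \<and>
      (\<Theta>_converges q 0 \<and> \<Theta>_converges q 1 \<longrightarrow>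
        (\<forall>a\<in>{0..1}.
          (\<exists>!\<pi>. stationary q \<pi> \<and> measure \<pi> {sconst 1} = a) \<and>
          (\<forall>\<pi>. stationary q \<pi> \<longrightarrow>
             (measure \<pi> {sconst 1} = a \<longleftrightarrow>
               word_mass \<pi> [1] = (a * \<Theta> q 0 + \<Theta> q 1) / (\<Theta> q 0 + \<Theta> q 1) \<and>
               word_mass \<pi> [0, 1] = (1 - a) / (\<Theta> q 0 + \<Theta> q 1) \<and>
               comb_formulae q \<pi>))))) \<and>

    (pmf (q (Inf_leaf 0)) 0 = 1 \<and> pmf (q (Inf_leaf 1)) 1 = 1 \<longrightarrow>
      (\<not> \<Theta>_converges q 0 \<or> \<not> \<Theta>_converges q 1 \<longrightarrow>
        (\<forall>a\<in>{0..1}.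
          (\<exists>!\<pi>. stationary q \<pi> \<and> measure \<pi> {sconst 0} = a) \<and>
          (\<forall>\<pi>\<in>space (prob_algebra left_words).
             (stationary q \<pi> \<and> measure \<pi> {sconst 0} = a \<longleftrightarrow>
               (\<forall>n\<ge>1. word_mass \<pi> (replicate n 0) = a) \<and>
               (\<forall>n\<ge>1. word_mass \<pi> (replicate n 1) = 1 - a) \<and>
               (\<forall>w. 0 \<in> set w \<and> 1 \<in> set w \<longrightarrow> word_mass \<pi> w = 0))))) \<and>
      (\<Theta>_converges q 0 \<and> \<Theta>_converges q 1 \<longrightarrow>
        (\<forall>a\<in>{0..1}. \<forall>b\<in>{0..1}. a + b \<le> 1 \<longrightarrow>
          (\<exists>!\<pi>. stationary q \<pi> \<and> measure \<pi> {sconst 0} = a \<and> measure \<pi> {sconst 1} = b) \<and>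
          (\<forall>\<pi>. stationary q \<pi> \<longrightarrow>
             (measure \<pi> {sconst 0} = a \<and> measure \<pi> {sconst 1} = b \<longleftrightarrow>
               word_mass \<pi> [0] = (a * \<Theta> q 1 + (1 - b) * \<Theta> q 0) / (\<Theta> q 0 + \<Theta> q 1) \<and>
               word_mass \<pi> [1, 0] = (1 - a - b) / (\<Theta> q 0 + \<Theta> q 1) \<and>
               comb_formulae q \<pi>)))))"
proof ((rule conjI[OF _ conjI[OF _ conjI]]; rule impI; elim conjE), goal_cases)
  case 1
  then have p: "pmf (q (Inf_leaf x)) x \<noteq> 1" for x
    by (cases x) auto
  show ?case
    by (rule no_absorbing[of q, OF p, unfolded all_bit])
next
  case 2
  show ?case
  proof (rule conjI; intro impI ballI)
    assume "\<not> \<Theta>_converges q 0 \<or> \<not> \<Theta>_converges q 1"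
    then show "(\<exists>!\<pi>. stationary q \<pi>) \<and>
        (\<forall>\<pi>\<in>space (prob_algebra left_words). stationary q \<pi> \<longleftrightarrow> measure \<pi> {sconst 0} = 1)"
      by (intro one_absorbing_divergent) (use 2 in \<open>simp_all add: all_bit\<close>)
  qed (rule one_absorbing_convergent[of q 0, unfolded all_bit opp_simps]; use 2 in simp)
next
  case 3
  show ?case
  proof (rule conjI; intro impI ballI)
    assume "\<not> \<Theta>_converges q 0 \<or> \<not> \<Theta>_converges q 1"
    then show "(\<exists>!\<pi>. stationary q \<pi>) \<and>
        (\<forall>\<pi>\<in>space (prob_algebra left_words). stationary q \<pi> \<longleftrightarrow> measure \<pi> {sconst 1} = 1)"
      by (intro one_absorbing_divergent) (use 3 in \<open>simp_all add: all_bit\<close>)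
  qed (rule one_absorbing_convergent[of q 1, unfolded all_bit opp_simps add.commute[of "\<Theta> q 1" "\<Theta> q 0"]];
      use 3 in simp)
next
  case 4
  then have p: "pmf (q (Inf_leaf x)) x = 1" for x
    by (cases x) auto
  show ?case
    by (rule conjI; intro impI ballI)
       (rule two_absorbing_divergent[of q, OF p, unfolded all_bit]
             two_absorbing_convergent[of q, OF p, unfolded all_bit]; simp)+
qed

end
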